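(* Let $d\ge 2$, $\beta>0$, $J\in\{-1,+1\}$ and $h=0$. Let $\mathbb{P}$ be the law on $\Omega=\{-1,+1\}^{\mathbb{Z}^d}$ of a Markov random field $\mathbb{X}=\{X_x\}_{x\in\mathbb{Z}^d}$ whose single-site conditional probabilities are $$\mathbb{P}\big(X_x=+1\,\big|\,X_{\mathbb{Z}^d\setminus x}=\sigma_{\mathbb{Z}^d\setminus x}\big)=\frac{e^{\beta h}e^{\beta J\sum_{y\sim x}\sigma_y}}{2\cosh\big(\beta h+\beta J\sum_{y\sim x}\sigma_y\big)}$$ (with $h=0$). Set $c=2\beta h+4\beta d$ and $p=e^{-2\beta h}\big(e^{4\beta d}-e^{-4\beta d}\big)$ (so here $c=4\beta d$, $p=e^{4\beta d}-e^{-4\beta d}$), and assume $p<1$ and $$\mathbb{E}_p\big(|\mathcal{C}|e^{c|\mathcal{C}|}\big)<\infty,$$ where $\mathcal{C}$ is the open cluster of the origin in independent Bernoulli site percolation on $\mathbb{Z}^d$ with parameter $p$, and $\mathbb{E}_p$ is expectation under that percolation measure. Then $\mathbb{P}$ satisfies the Poincaré inequality: there is a constant $C_P>0$ such that for all $f\in L^2(\mathbb{P})$, $$\int \big(f-\mathbb{E}(f)\big)^2\,d\mathbb{P}\le C_P\,\mathcal{E}(f,f).$$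
   Context: $x\sim y$ means $x,y$ are nearest neighbours in $\mathbb{Z}^d$. For $\eta\in\Omega$ and $x\in\mathbb{Z}^d$, $\eta^x$ denotes the configuration obtained from $\eta$ by flipping the spin at $x$ (i.e. $\eta^x_x=-\eta_x$, $\eta^x_y=\eta_y$ for $y\ne x$), and $\nabla_x f(\eta)=f(\eta^x)-f(\eta)$. The quadratic form is $\mathcal{E}(f,f)=\sum_{x\in\mathbb{Z}^d}\int(\nabla_x f)^2\,d\mathbb{P}$ (possibly infinite). *)

theory Defs
  imports "HOL-Probability.Probability"
begin

text \<open>Sites of the lattice Z^d are functions 'd => int with 'd a finite index type,
  d = CARD('d). Spin configurations are functions from sites to {-1,+1}.\<close>

type_synonym 'd site = "'d \<Rightarrow> int"
type_synonym 'd config = "'d site \<Rightarrow> int"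

definition nbr :: "'d::finite site \<Rightarrow> 'd site \<Rightarrow> bool" where
  "nbr x y \<longleftrightarrow> (\<Sum>i\<in>UNIV. \<bar>x i - y i\<bar>) = 1"

definition spin_space :: "'d::finite config measure" where
  "spin_space = PiM UNIV (\<lambda>_. count_space {-1, 1})"

definition flip :: "'d site \<Rightarrow> 'd config \<Rightarrow> 'd config" where
  "flip x \<sigma> = \<sigma>(x := - \<sigma> x)"

definition local_field :: "'d::finite config \<Rightarrow> 'd site \<Rightarrow> real" where
  "local_field \<sigma> x = (\<Sum>y\<in>{y. nbr x y}. real_of_int (\<sigma> y))"

definition cond_plus :: "real \<Rightarrow> real \<Rightarrow> real \<Rightarrow> 'd::finite config \<Rightarrow> 'd site \<Rightarrow> real" where
  "cond_plus \<beta> J h \<sigma> x =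
     exp (\<beta> * h) * exp (\<beta> * J * local_field \<sigma> x) / (2 * cosh (\<beta> * h + \<beta> * J * local_field \<sigma> x))"

definition outside_sigma :: "'d::finite site \<Rightarrow> 'd config set set" where
  "outside_sigma x = sigma_sets (space spin_space)
     {(\<lambda>\<sigma>. \<sigma> y) -` {s} \<inter> space spin_space | y s. y \<noteq> x}"

text \<open>P is the law of a Markov random field on {-1,+1}^(Z^d) with the given single-site
  conditional probabilities: P(X_x = +1 | F_{x^c}) = cond_plus, i.e. for every A in F_{x^c},
  P({X_x = 1} \<inter> A) = integral over A of cond_plus.\<close>
definition ising_mrf :: "real \<Rightarrow> real \<Rightarrow> real \<Rightarrow> 'd::finite config measure \<Rightarrow> bool" where
  "ising_mrf \<beta> J h P \<longleftrightarrow> prob_space P \<and> sets P = sets spin_space \<and>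
     (\<forall>x. \<forall>A \<in> outside_sigma x.
        measure P ({\<sigma> \<in> space P. \<sigma> x = 1} \<inter> A) = (\<integral>\<sigma>. indicator A \<sigma> * cond_plus \<beta> J h \<sigma> x \<partial>P))"

definition perc :: "real \<Rightarrow> ('d::finite site \<Rightarrow> bool) measure" where
  "perc p = PiM UNIV (\<lambda>_. measure_pmf (bernoulli_pmf p))"

definition open_cluster :: "('d::finite site \<Rightarrow> bool) \<Rightarrow> 'd site set" where
  "open_cluster \<omega> = {y. \<omega> (\<lambda>_. 0) \<and> (\<lambda>a b. nbr a b \<and> \<omega> a \<and> \<omega> b)\<^sup>*\<^sup>* (\<lambda>_. 0) y}"

definition cluster_weight :: "real \<Rightarrow> ('d::finite site \<Rightarrow> bool) \<Rightarrow> ennreal" where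
  "cluster_weight c \<omega> = (if finite (open_cluster \<omega>)
     then ennreal (real (card (open_cluster \<omega>)) * exp (c * real (card (open_cluster \<omega>))))
     else \<infinity>)"

definition dirichlet :: "'d::finite config measure \<Rightarrow> ('d config \<Rightarrow> real) \<Rightarrow> ennreal" where
  "dirichlet P f = (\<integral>\<^sup>+ x. (\<integral>\<^sup>+ \<sigma>. ennreal ((f (flip x \<sigma>) - f \<sigma>)\<^sup>2) \<partial>P) \<partial>count_space UNIV)"

end

theory Submission
  imports Defs
begin

text \<open>The assumption \<open>p < 1\<close> forces \<open>4 * \<beta> * d < 5/8\<close>, which puts the field deep inside
  Dobrushin's uniqueness regime, where a Poincare inequality holds. Let \<open>E x\<close> resample the spin
  at \<open>x\<close> from its conditional law and let \<open>a x f\<close> be the \<open>L\<^sup>2\<close> norm of the discrete gradient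
  \<open>D x f\<close>. Then \<open>E x\<close> is a self-adjoint contraction, it kills \<open>a x\<close>, raises \<open>a y\<close> by at most
  \<open>2 * \<beta> * a x f\<close> for neighbours \<open>y\<close> of \<open>x\<close>, and lowers an inner product \<open>\<langle>f, g\<rangle>\<close> by at most
  \<open>a x f * a x g\<close>. Applying resamplings one after the other to a centred \<open>f\<close> therefore bounds
  \<open>\<langle>f, f\<rangle>\<close> by \<open>\<Sum> U x * a x f\<close> plus a remainder, where the total removed oscillation satisfies
  \<open>U y \<le> a y f + 2 * \<beta> * (\<Sum> U z)\<close>, summing over the neighbours \<open>z\<close> of \<open>y\<close>; a quadratic estimate
  turns this into \<open>\<Sum> (a x f)\<^sup>2 / (1 - 4 * \<beta> * d)\<close>. The remainder is made small by a choice of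
  updates depending only on a local approximation of \<open>f\<close>, on which repeated sweeps contract the
  supremum oscillation; so \<open>f\<close> itself need not be local.\<close>

section \<open>Square-integrable functions\<close>

definition sq_integrable :: "'a measure \<Rightarrow> ('a \<Rightarrow> real) \<Rightarrow> bool" where
  "sq_integrable M f \<longleftrightarrow> f \<in> borel_measurable M \<and> integrable M (\<lambda>x. (f x)\<^sup>2)"

definition l2norm :: "'a measure \<Rightarrow> ('a \<Rightarrow> real) \<Rightarrow> real" where
  "l2norm M f = sqrt (\<integral>x. (f x)\<^sup>2 \<partial>M)"

lemma l2norm_nonneg [simp]: "0 \<le> l2norm M f"
  by (simp add: l2norm_def)

lemma l2norm_square: "(l2norm M f)\<^sup>2 = (\<integral>x. (f x)\<^sup>2 \<partial>M)"
  by (simp add: l2norm_def)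

lemma sq_integrableD [measurable_dest]: "sq_integrable M f \<Longrightarrow> f \<in> borel_measurable M"
  by (simp add: sq_integrable_def)

lemma integrable_mult_sq:
  assumes "sq_integrable M f" "sq_integrable M g"
  shows "integrable M (\<lambda>x. f x * g x)"
proof (rule Bochner_Integration.integrable_bound)
  show "integrable M (\<lambda>x. (f x)\<^sup>2 + (g x)\<^sup>2)"
    using assms by (auto simp: sq_integrable_def)
  show "(\<lambda>x. f x * g x) \<in> borel_measurable M"
    using assms by (auto simp: sq_integrable_def)
  have "\<bar>u * v\<bar> \<le> u\<^sup>2 + v\<^sup>2" for u v :: real
  proof -
    have "2 * (\<bar>u\<bar> * \<bar>v\<bar>) \<le> u\<^sup>2 + v\<^sup>2"
      using sum_squares_bound[of "\<bar>u\<bar>" "\<bar>v\<bar>"] by (simp add: mult.assoc)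
    moreover have "0 \<le> \<bar>u\<bar> * \<bar>v\<bar>" by simp
    ultimately show ?thesis unfolding abs_mult by linarith
  qed
  then show "AE x in M. norm (f x * g x) \<le> norm ((f x)\<^sup>2 + (g x)\<^sup>2)" by simp
qed

lemma sq_integrable_bound:
  assumes "sq_integrable M g" "f \<in> borel_measurable M"
    and "\<And>x. x \<in> space M \<Longrightarrow> \<bar>f x\<bar> \<le> \<bar>g x\<bar>"
  shows "sq_integrable M f"
  unfolding sq_integrable_def
proof (intro conjI assms(2))
  show "integrable M (\<lambda>x. (f x)\<^sup>2)"
  proof (rule Bochner_Integration.integrable_bound)
    show "integrable M (\<lambda>x. (g x)\<^sup>2)" using assms(1) by (auto simp: sq_integrable_def)
    show "(\<lambda>x. (f x)\<^sup>2) \<in> borel_measurable M" using assms(2) by measurable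
    show "AE x in M. norm ((f x)\<^sup>2) \<le> norm ((g x)\<^sup>2)"
      using assms(3) by (auto simp: abs_le_square_iff)
  qed
qed

lemma l2norm_mono:
  assumes "sq_integrable M g" "f \<in> borel_measurable M"
    and "\<And>x. x \<in> space M \<Longrightarrow> \<bar>f x\<bar> \<le> \<bar>g x\<bar>"
  shows "l2norm M f \<le> l2norm M g"
proof -
  have "sq_integrable M f" by (rule sq_integrable_bound[OF assms])
  then show ?thesis
    using assms unfolding l2norm_def sq_integrable_def
    by (intro real_sqrt_le_mono integral_mono) (auto simp: abs_le_square_iff)
qed

lemma sq_integrable_cmult:
  assumes "sq_integrable M f"
  shows "sq_integrable M (\<lambda>x. a * f x)"
  using assms by (auto simp: sq_integrable_def power_mult_distrib)

lemma l2norm_cmult: "l2norm M (\<lambda>x. a * f x) = \<bar>a\<bar> * l2norm M f"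
  by (simp add: l2norm_def power_mult_distrib real_sqrt_mult)

lemma sq_integrable_add:
  assumes "sq_integrable M f" "sq_integrable M g"
  shows "sq_integrable M (\<lambda>x. f x + g x)"
proof -
  have "integrable M (\<lambda>x. (f x)\<^sup>2 + (g x)\<^sup>2 + 2 * (f x * g x))"
    using assms integrable_mult_sq[OF assms] by (auto simp: sq_integrable_def)
  then have "integrable M (\<lambda>x. (f x + g x)\<^sup>2)"
    by (simp add: power2_sum algebra_simps)
  then show ?thesis using assms by (auto simp: sq_integrable_def)
qed

lemma sq_integrable_diff:
  assumes "sq_integrable M f" "sq_integrable M g"
  shows "sq_integrable M (\<lambda>x. f x - g x)"
  using sq_integrable_add[OF assms(1) sq_integrable_cmult[OF assms(2), of "-1"]] by simp

lemma sq_integrable_abs: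
  assumes "sq_integrable M f" shows "sq_integrable M (\<lambda>x. \<bar>f x\<bar>)"
  using assms by (auto simp: sq_integrable_def)

text \<open>The integral of the square of \<open>s * f + t * g\<close> is a nonnegative quadratic
  form in \<open>s\<close> and \<open>t\<close>; evaluating it at one suitable point gives the
  discriminant inequality, with \<open>B = 0\<close> treated apart.\<close>

lemma l2norm_Cauchy_Schwarz:
  assumes "sq_integrable M f" "sq_integrable M g"
  shows "\<bar>\<integral>x. f x * g x \<partial>M\<bar> \<le> l2norm M f * l2norm M g"
proof -
  define A where "A = (\<integral>x. (f x)\<^sup>2 \<partial>M)"
  define B where "B = (\<integral>x. (g x)\<^sup>2 \<partial>M)"
  define C where "C = (\<integral>x. f x * g x \<partial>M)"
  have i: "integrable M (\<lambda>x. (f x)\<^sup>2)" "integrable M (\<lambda>x. (g x)\<^sup>2)" "integrable M (\<lambda>x. f x * g x)"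
    using assms integrable_mult_sq[OF assms] by (auto simp: sq_integrable_def)
  have q: "0 \<le> A * s\<^sup>2 + 2 * s * t * C + B * t\<^sup>2" for s t
  proof -
    have "0 \<le> (\<integral>x. (s * f x + t * g x)\<^sup>2 \<partial>M)" by simp
    also have "(\<lambda>x. (s * f x + t * g x)\<^sup>2) = (\<lambda>x. s\<^sup>2 * (f x)\<^sup>2 + 2 * s * t * (f x * g x) + t\<^sup>2 * (g x)\<^sup>2)"
      by (auto simp: power2_eq_square algebra_simps)
    also have "(\<integral>x. s\<^sup>2 * (f x)\<^sup>2 + 2 * s * t * (f x * g x) + t\<^sup>2 * (g x)\<^sup>2 \<partial>M)
       = s\<^sup>2 * A + 2 * s * t * C + t\<^sup>2 * B"
      using i by (simp add: A_def B_def C_def)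
    finally show ?thesis by (simp add: algebra_simps)
  qed
  have AB: "A \<ge> 0" "B \<ge> 0" by (auto simp: A_def B_def)
  have "C\<^sup>2 \<le> A * B"
  proof (cases "B = 0")
    case True
    have "C = 0"
    proof (rule ccontr)
      assume "C \<noteq> 0"
      \<comment> \<open>With \<open>B = 0\<close> the form is affine in \<open>t\<close>, and this
        \<open>t\<close> is picked to give the value \<open>A - (A + 1) = -1\<close>.\<close>
      have "0 \<le> A * 1\<^sup>2 + 2 * 1 * (- (A + 1) / (2 * C)) * C" using q[of 1 "- (A + 1) / (2 * C)"] True by simp
      also have "\<dots> = -1" using \<open>C \<noteq> 0\<close> by (simp add: field_simps)
      finally show False by simp
    qed
    then show ?thesis using AB by simp
  next
    case False
    \<comment> \<open>At the point \<open>(B, -C)\<close> the form factors into \<open>B\<close>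
      times the difference that has to be nonnegative.\<close>
    have "0 \<le> A * B\<^sup>2 + 2 * B * (-C) * C + B * (-C)\<^sup>2" by (rule q)
    also have "\<dots> = B * (A * B - C\<^sup>2)" by (simp add: power2_eq_square algebra_simps)
    finally show ?thesis using False AB by (simp add: zero_le_mult_iff)
  qed
  then have "\<bar>C\<bar> \<le> sqrt (A * B)" by (simp add: real_le_rsqrt)
  then show ?thesis by (simp add: A_def B_def C_def l2norm_def real_sqrt_mult)
qed

lemma l2norm_triangle:
  assumes "sq_integrable M f" "sq_integrable M g"
  shows "l2norm M (\<lambda>x. f x + g x) \<le> l2norm M f + l2norm M g"
proof (rule power2_le_imp_le)
  have i: "integrable M (\<lambda>x. (f x)\<^sup>2)" "integrable M (\<lambda>x. (g x)\<^sup>2)" "integrable M (\<lambda>x. f x * g x)"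
    using assms integrable_mult_sq[OF assms] by (auto simp: sq_integrable_def)
  have "(l2norm M (\<lambda>x. f x + g x))\<^sup>2 = (\<integral>x. (f x)\<^sup>2 + 2 * (f x * g x) + (g x)\<^sup>2 \<partial>M)"
    unfolding l2norm_square by (simp add: power2_sum algebra_simps)
  also have "\<dots> = (l2norm M f)\<^sup>2 + 2 * (\<integral>x. f x * g x \<partial>M) + (l2norm M g)\<^sup>2"
    using i by (simp add: l2norm_square)
  also have "\<dots> \<le> (l2norm M f + l2norm M g)\<^sup>2"
    using l2norm_Cauchy_Schwarz[OF assms] by (simp add: power2_sum)
  finally show "(l2norm M (\<lambda>x. f x + g x))\<^sup>2 \<le> (l2norm M f + l2norm M g)\<^sup>2" .
qed simp

lemma l2norm_cong:
  assumes "\<And>x. x \<in> space M \<Longrightarrow> f x = g x"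
  shows "l2norm M f = l2norm M g"
  unfolding l2norm_def using assms by (simp cong: Bochner_Integration.integral_cong)

text \<open>Dominated convergence: as \<open>U n\<close> lies between 0 and \<open>u\<close>, the
  squared error is at most the square of \<open>u\<close>. Serves the increasing approximations in
  the density argument.\<close>

lemma l2norm_limit:
  assumes u: "sq_integrable M u"
    and U: "\<And>n. U n \<in> borel_measurable M" "\<And>n x. x \<in> space M \<Longrightarrow> 0 \<le> U n x"
      "\<And>n x. x \<in> space M \<Longrightarrow> U n x \<le> u x"
    and lim: "\<And>x. x \<in> space M \<Longrightarrow> (\<lambda>n. U n x) \<longlonglongrightarrow> u x"
  shows "(\<lambda>n. l2norm M (\<lambda>x. u x - U n x)) \<longlonglongrightarrow> 0"
proof -
  have [measurable]: "u \<in> borel_measurable M" using u by (rule sq_integrableD)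
  note [measurable] = U(1)
  have "(\<lambda>n. \<integral>x. (u x - U n x)\<^sup>2 \<partial>M) \<longlonglongrightarrow> (\<integral>x. 0 \<partial>M)"
  proof (rule integral_dominated_convergence)
    show "integrable M (\<lambda>x. (u x)\<^sup>2)" using u by (simp add: sq_integrable_def)
    show "AE x in M. (\<lambda>n. (u x - U n x)\<^sup>2) \<longlonglongrightarrow> 0"
    proof (rule AE_I2)
      fix x assume "x \<in> space M"
      then have "(\<lambda>n. (u x - U n x)\<^sup>2) \<longlonglongrightarrow> (u x - u x)\<^sup>2"
        by (intro tendsto_intros lim)
      then show "(\<lambda>n. (u x - U n x)\<^sup>2) \<longlonglongrightarrow> 0" by simp
    qed
    show "AE x in M. norm ((u x - U n x)\<^sup>2) \<le> (u x)\<^sup>2" for n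
    proof (rule AE_I2)
      fix x assume "x \<in> space M"
      then have "\<bar>u x - U n x\<bar> \<le> \<bar>u x\<bar>" using U(2,3)[of x n] by linarith
      then show "norm ((u x - U n x)\<^sup>2) \<le> (u x)\<^sup>2" by (simp add: abs_le_square_iff)
    qed
  qed auto
  then show ?thesis unfolding l2norm_def using tendsto_real_sqrt by fastforce
qed

lemma (in prob_space) sq_integrable_bounded:
  assumes "f \<in> borel_measurable M" "\<And>x. x \<in> space M \<Longrightarrow> \<bar>f x\<bar> \<le> K"
  shows "sq_integrable M f"
proof (rule sq_integrable_bound[OF _ assms(1)])
  show "sq_integrable M (\<lambda>_. K)" by (simp add: sq_integrable_def)
  show "\<bar>f x\<bar> \<le> \<bar>K\<bar>" if "x \<in> space M" for x using assms(2)[OF that] by simp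
qed

lemma (in prob_space) l2norm_bounded:
  assumes "f \<in> borel_measurable M" "\<And>x. x \<in> space M \<Longrightarrow> \<bar>f x\<bar> \<le> K" "K \<ge> 0"
  shows "l2norm M f \<le> K"
proof -
  have "l2norm M f \<le> l2norm M (\<lambda>_. K)"
    using assms by (intro l2norm_mono) (auto simp: sq_integrable_def)
  also have "\<dots> = K" using assms(3) by (simp add: l2norm_def prob_space)
  finally show ?thesis .
qed

section \<open>Single-site resampling\<close>

locale spin_field = prob_space P for P :: "('a \<Rightarrow> int) measure" +
  assumes sets_P: "sets P = sets (PiM UNIV (\<lambda>_. count_space {-1, 1}))"
begin

lemma space_P: "space P = {\<sigma>. \<forall>x. \<sigma> x \<in> {-1, 1}}"
  using sets_eq_imp_space_eq[OF sets_P] by (auto simp: space_PiM PiE_def Pi_def)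

lemma upd_space [simp]: "\<sigma> \<in> space P \<Longrightarrow> s \<in> {-1, 1} \<Longrightarrow> \<sigma>(x := s) \<in> space P"
  by (auto simp: space_P)

lemma measurable_coord: "(\<lambda>\<sigma>. \<sigma> y) \<in> measurable P (count_space {-1, 1})"
  using measurable_component_singleton[of y UNIV "\<lambda>_. count_space {-1, 1}"]
  by (simp add: measurable_cong_sets[OF sets_P refl])

lemma measurable_upd:
  assumes "s \<in> {-1, 1}"
  shows "(\<lambda>\<sigma>. \<sigma>(x := s)) \<in> measurable P P"
proof -
  have "(\<lambda>\<sigma> i. if i = x then s else \<sigma> i) \<in> measurable P (PiM UNIV (\<lambda>_. count_space {-1, 1}))"
  proof (rule measurable_PiM_single')
    fix i show "(\<lambda>\<sigma>. if i = x then s else \<sigma> i) \<in> measurable P (count_space {-1, 1})"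
      using assms measurable_coord[of i] by (cases "i = x") auto
  next
    show "(\<lambda>\<sigma> i. if i = x then s else \<sigma> i) \<in> space P \<rightarrow> (\<Pi>\<^sub>E i\<in>UNIV. space (count_space {-1, 1}))"
      using assms by (fastforce simp: space_P)
  qed
  then show ?thesis
    by (simp add: fun_upd_def measurable_cong_sets[OF refl sets_P])
qed

lemma measurable_upd_comp:
  assumes "f \<in> measurable P R"
  shows "(\<lambda>\<sigma>. f (\<sigma>(x := 1))) \<in> measurable P R" "(\<lambda>\<sigma>. f (\<sigma>(x := -1))) \<in> measurable P R"
  by (rule measurable_compose[OF measurable_upd assms]; simp)+

end

text \<open>The value \<open>q x \<sigma>\<close> is the conditional probability of spin 1 at \<open>x\<close> given the other spins;
  \<open>b\<close> bounds the influence of one neighbour, and \<open>2 * b * m < 1\<close> is a quantitative form of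
  Dobrushin's uniqueness condition.\<close>

locale weakly_dependent_field = spin_field P for P :: "('a \<Rightarrow> int) measure" +
  fixes q :: "'a \<Rightarrow> ('a \<Rightarrow> int) \<Rightarrow> real" and N :: "'a \<Rightarrow> 'a set" and b :: real and m :: nat
  assumes q_measurable [measurable]: "q x \<in> borel_measurable P"
    and q_bounds: "\<sigma> \<in> space P \<Longrightarrow> 1/3 \<le> q x \<sigma> \<and> q x \<sigma> \<le> 2/3"
    and q_influence: "\<sigma> \<in> space P \<Longrightarrow> \<tau> \<in> space P \<Longrightarrow>
      \<bar>q x \<sigma> - q x \<tau>\<bar> \<le> b * real (card {y \<in> N x. \<sigma> y \<noteq> \<tau> y})"
    and N_irrefl: "x \<notin> N x" and N_sym: "y \<in> N x \<longleftrightarrow> x \<in> N y"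
    and N_finite: "finite (N x)" and N_card: "card (N x) \<le> m"
    and b_nonneg: "0 \<le> b" and b_small: "2 * b * real m < 1"
    and nn_integral_resample: "F \<in> borel_measurable P \<Longrightarrow>
      (\<integral>\<^sup>+\<sigma>. F \<sigma> \<partial>P) =
      (\<integral>\<^sup>+\<sigma>. ennreal (q x \<sigma>) * F (\<sigma>(x := 1)) + ennreal (1 - q x \<sigma>) * F (\<sigma>(x := -1)) \<partial>P)"
begin

text \<open>The conditional expectation given all spins off \<open>x\<close>, written as an explicit
  function rather than a class modulo null sets, so that pointwise and supremum estimates apply to
  iterated updates.\<close>

definition E :: "'a \<Rightarrow> (('a \<Rightarrow> int) \<Rightarrow> real) \<Rightarrow> ('a \<Rightarrow> int) \<Rightarrow> real" where
  "E x f \<sigma> = q x \<sigma> * f (\<sigma>(x := 1)) + (1 - q x \<sigma>) * f (\<sigma>(x := -1))"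

text \<open>The sign is fixed by the spin values, so the result does not depend on the spin at
  \<open>x\<close>; on spin configurations it agrees with the flip gradient up to sign.\<close>

definition D :: "'a \<Rightarrow> (('a \<Rightarrow> int) \<Rightarrow> real) \<Rightarrow> ('a \<Rightarrow> int) \<Rightarrow> real" where
  "D x f \<sigma> = f (\<sigma>(x := 1)) - f (\<sigma>(x := -1))"

lemma measurable_E [measurable]:
  assumes [measurable]: "f \<in> borel_measurable P"
  shows "E x f \<in> borel_measurable P"
proof -
  note [measurable] = measurable_upd_comp(1)[OF assms, of x] measurable_upd_comp(2)[OF assms, of x]
  show ?thesis unfolding E_def[abs_def] by measurable
qed

lemma measurable_D [measurable]:
  assumes "f \<in> borel_measurable P"
  shows "D x f \<in> borel_measurable P"
proof -
  note [measurable] = measurable_upd_comp(1)[OF assms, of x] measurable_upd_comp(2)[OF assms, of x]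
  show ?thesis unfolding D_def[abs_def] by measurable
qed

text \<open>No site is its own neighbour, so changing the spin at \<open>x\<close> creates no
  disagreement inside \<open>N x\<close>, and \<open>q_influence\<close> gives distance 0.\<close>

lemma q_upd:
  assumes "\<sigma> \<in> space P" "s \<in> {-1, 1}"
  shows "q x (\<sigma>(x := s)) = q x \<sigma>"
proof -
  have e: "{y \<in> N x. (\<sigma>(x := s)) y \<noteq> \<sigma> y} = {}" using N_irrefl by auto
  show ?thesis using q_influence[OF upd_space[OF assms] assms(1), of x x] unfolding e by simp
qed

text \<open>Stationarity of \<open>P\<close> under resampling. The assumption
  \<open>nn_integral_resample\<close> concerns extended nonnegative integrals, so this case comes
  first; \<open>integral_E\<close> then splits into positive and negative parts.\<close>

lemma integral_E_nonneg:
  fixes F :: "('a \<Rightarrow> int) \<Rightarrow> real"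
  assumes "integrable P F" "\<And>\<sigma>. 0 \<le> F \<sigma>"
  shows "integrable P (E x F)" "(\<integral>\<sigma>. E x F \<sigma> \<partial>P) = (\<integral>\<sigma>. F \<sigma> \<partial>P)"
proof -
  have [measurable]: "F \<in> borel_measurable P" using assms by simp
  have E0: "0 \<le> E x F \<sigma>" if "\<sigma> \<in> space P" for \<sigma>
    unfolding E_def using assms(2) q_bounds[OF that, of x]
    by (intro add_nonneg_nonneg mult_nonneg_nonneg) auto
  have "(\<integral>\<^sup>+\<sigma>. ennreal (F \<sigma>) \<partial>P) =
      (\<integral>\<^sup>+\<sigma>. ennreal (q x \<sigma>) * ennreal (F (\<sigma>(x := 1))) +
        ennreal (1 - q x \<sigma>) * ennreal (F (\<sigma>(x := -1))) \<partial>P)"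
    by (rule nn_integral_resample) simp
  also have "\<dots> = (\<integral>\<^sup>+\<sigma>. ennreal (E x F \<sigma>) \<partial>P)"
  proof (rule nn_integral_cong)
    fix \<sigma> assume "\<sigma> \<in> space P"
    then have "0 \<le> q x \<sigma>" "0 \<le> 1 - q x \<sigma>" using q_bounds[of \<sigma> x] by auto
    then show "ennreal (q x \<sigma>) * ennreal (F (\<sigma>(x := 1))) +
        ennreal (1 - q x \<sigma>) * ennreal (F (\<sigma>(x := -1))) = ennreal (E x F \<sigma>)"
      using assms(2) by (simp add: E_def ennreal_mult' ennreal_plus)
  qed
  finally have eq: "(\<integral>\<^sup>+\<sigma>. ennreal (F \<sigma>) \<partial>P) = (\<integral>\<^sup>+\<sigma>. ennreal (E x F \<sigma>) \<partial>P)" .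
  have F: "(\<integral>\<^sup>+\<sigma>. ennreal (F \<sigma>) \<partial>P) = ennreal (\<integral>\<sigma>. F \<sigma> \<partial>P)"
    using assms by (intro nn_integral_eq_integral) auto
  show i: "integrable P (E x F)"
  proof (rule integrableI_nonneg)
    show "(\<integral>\<^sup>+\<sigma>. ennreal (E x F \<sigma>) \<partial>P) < \<infinity>" unfolding eq[symmetric] F by simp
  qed (auto simp: E0)
  have "(\<integral>\<^sup>+\<sigma>. ennreal (E x F \<sigma>) \<partial>P) = ennreal (\<integral>\<sigma>. E x F \<sigma> \<partial>P)"
    using i E0 by (intro nn_integral_eq_integral) auto
  then show "(\<integral>\<sigma>. E x F \<sigma> \<partial>P) = (\<integral>\<sigma>. F \<sigma> \<partial>P)"
    using eq F E0 assms(2) by (simp add: integral_nonneg_AE)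
qed

lemma integral_E:
  fixes F :: "('a \<Rightarrow> int) \<Rightarrow> real"
  assumes "integrable P F"
  shows "integrable P (E x F)" "(\<integral>\<sigma>. E x F \<sigma> \<partial>P) = (\<integral>\<sigma>. F \<sigma> \<partial>P)"
proof -
  let ?p = "\<lambda>\<sigma>. max 0 (F \<sigma>)" and ?n = "\<lambda>\<sigma>. max 0 (- F \<sigma>)"
  have ip: "integrable P ?p" and "in": "integrable P ?n"
    using assms by auto
  have eq: "E x F \<sigma> = E x ?p \<sigma> - E x ?n \<sigma>" for \<sigma>
    unfolding E_def by (auto simp: max_def algebra_simps)
  have Feq: "F \<sigma> = ?p \<sigma> - ?n \<sigma>" for \<sigma> by auto
  note p = integral_E_nonneg[OF ip, of x] and n = integral_E_nonneg[OF "in", of x]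
  show "integrable P (E x F)"
    unfolding eq[abs_def] using p(1) n(1) by auto
  have "(\<integral>\<sigma>. E x F \<sigma> \<partial>P) = (\<integral>\<sigma>. ?p \<sigma> \<partial>P) - (\<integral>\<sigma>. ?n \<sigma> \<partial>P)"
    unfolding eq using p n by simp
  also have "\<dots> = (\<integral>\<sigma>. ?p \<sigma> - ?n \<sigma> \<partial>P)" using ip "in" by simp
  also have "\<dots> = (\<integral>\<sigma>. F \<sigma> \<partial>P)" by (subst (2) Feq) simp
  finally show "(\<integral>\<sigma>. E x F \<sigma> \<partial>P) = (\<integral>\<sigma>. F \<sigma> \<partial>P)" .
qed

text \<open>Since both conditional probabilities are at least 1/3, pinning a spin costs a factor 3.\<close>

lemma integral_pinned:
  fixes F :: "('a \<Rightarrow> int) \<Rightarrow> real"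
  assumes "integrable P F" "\<And>\<sigma>. 0 \<le> F \<sigma>"
  shows "integrable P (\<lambda>\<sigma>. F (\<sigma>(x := 1)))" "integrable P (\<lambda>\<sigma>. F (\<sigma>(x := -1)))"
    "(\<integral>\<sigma>. F (\<sigma>(x := 1)) + F (\<sigma>(x := -1)) \<partial>P) \<le> 3 * (\<integral>\<sigma>. F \<sigma> \<partial>P)"
proof -
  have [measurable]: "F \<in> borel_measurable P" using assms by simp
  have le: "F (\<sigma>(x := 1)) + F (\<sigma>(x := -1)) \<le> 3 * E x F \<sigma>" if "\<sigma> \<in> space P" for \<sigma>
  proof -
    have "1/3 * F (\<sigma>(x := 1)) \<le> q x \<sigma> * F (\<sigma>(x := 1))"
      "1/3 * F (\<sigma>(x := -1)) \<le> (1 - q x \<sigma>) * F (\<sigma>(x := -1))"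
      using q_bounds[OF that, of x] assms(2) by (intro mult_right_mono; simp)+
    then show ?thesis by (simp add: E_def)
  qed
  have iE: "integrable P (\<lambda>\<sigma>. 3 * E x F \<sigma>)" using integral_E(1)[OF assms(1)] by simp
  have ge: "\<bar>F (\<sigma>(x := s))\<bar> \<le> \<bar>3 * E x F \<sigma>\<bar>" if "\<sigma> \<in> space P" "s \<in> {-1, 1}" for \<sigma> s
    using le[OF that(1)] assms(2)[of "\<sigma>(x := 1)"] assms(2)[of "\<sigma>(x := -1)"] that(2) by auto
  show i1: "integrable P (\<lambda>\<sigma>. F (\<sigma>(x := 1)))"
    by (rule Bochner_Integration.integrable_bound[OF iE])
      (use ge in \<open>auto intro!: measurable_upd_comp\<close>)
  show i2: "integrable P (\<lambda>\<sigma>. F (\<sigma>(x := -1)))"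
    by (rule Bochner_Integration.integrable_bound[OF iE])
      (use ge in \<open>auto intro!: measurable_upd_comp\<close>)
  have "(\<integral>\<sigma>. F (\<sigma>(x := 1)) + F (\<sigma>(x := -1)) \<partial>P) \<le> (\<integral>\<sigma>. 3 * E x F \<sigma> \<partial>P)"
    using i1 i2 iE le by (intro integral_mono) auto
  then show "(\<integral>\<sigma>. F (\<sigma>(x := 1)) + F (\<sigma>(x := -1)) \<partial>P) \<le> 3 * (\<integral>\<sigma>. F \<sigma> \<partial>P)"
    using integral_E(2)[OF assms(1), of x] by simp
qed

section \<open>\<open>L2\<close> estimates for a single update\<close>

abbreviation "L2 \<equiv> sq_integrable P"
abbreviation "nrm \<equiv> l2norm P"

lemma L2_pinned:
  assumes "L2 f"
  shows "L2 (\<lambda>\<sigma>. f (\<sigma>(x := 1)))" "L2 (\<lambda>\<sigma>. f (\<sigma>(x := -1)))"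
  using assms integral_pinned[of "\<lambda>\<sigma>. (f \<sigma>)\<^sup>2" x] measurable_upd_comp[of f borel x]
  by (auto simp: sq_integrable_def)

lemma L2_D: "L2 f \<Longrightarrow> L2 (D x f)"
  unfolding D_def[abs_def] by (intro sq_integrable_diff L2_pinned)

text \<open>Jensen's inequality for a two-point law: the gap is the conditional variance,
  \<open>q * (1 - q)\<close> times the squared gradient. Integrated with \<open>integral_E\<close>,
  it makes \<open>E x\<close> an \<open>L2\<close> contraction.\<close>

lemma E_square_le:
  assumes "\<sigma> \<in> space P"
  shows "(E x f \<sigma>)\<^sup>2 \<le> E x (\<lambda>\<tau>. (f \<tau>)\<^sup>2) \<sigma>"
proof -
  have "E x (\<lambda>\<tau>. (f \<tau>)\<^sup>2) \<sigma> - (E x f \<sigma>)\<^sup>2 = (q x \<sigma> * (1 - q x \<sigma>)) * (D x f \<sigma>)\<^sup>2"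
    unfolding E_def D_def by (simp add: power2_eq_square algebra_simps)
  also have "\<dots> \<ge> 0" using q_bounds[OF assms, of x] by (intro mult_nonneg_nonneg) auto
  finally show ?thesis by simp
qed

lemma L2_E:
  assumes "L2 f"
  shows "L2 (E x f)" "nrm (E x f) \<le> nrm f"
proof -
  have [measurable]: "f \<in> borel_measurable P" using assms by (rule sq_integrableD)
  have i: "integrable P (\<lambda>\<sigma>. (f \<sigma>)\<^sup>2)" using assms by (simp add: sq_integrable_def)
  have i2: "integrable P (\<lambda>\<sigma>. (E x f \<sigma>)\<^sup>2)"
  proof (rule Bochner_Integration.integrable_bound[OF integral_E(1)[OF i, of x]])
    show "AE \<sigma> in P. norm ((E x f \<sigma>)\<^sup>2) \<le> norm (E x (\<lambda>\<sigma>. (f \<sigma>)\<^sup>2) \<sigma>)"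
      by (rule AE_I2) (use E_square_le in \<open>auto intro: order_trans[OF _ abs_ge_self]\<close>)
  qed simp
  then show "L2 (E x f)" by (simp add: sq_integrable_def)
  have "(\<integral>\<sigma>. (E x f \<sigma>)\<^sup>2 \<partial>P) \<le> (\<integral>\<sigma>. E x (\<lambda>\<tau>. (f \<tau>)\<^sup>2) \<sigma> \<partial>P)"
    using i2 integral_E(1)[OF i, of x] E_square_le by (intro integral_mono) auto
  then show "nrm (E x f) \<le> nrm f"
    unfolding l2norm_def integral_E(2)[OF i] by (rule real_sqrt_le_mono)
qed

text \<open>Neither \<open>q x\<close> nor the two pinned values of \<open>f\<close> depend on the
  spin at \<open>x\<close>.\<close>

lemma D_E_self:
  assumes "\<sigma> \<in> space P" shows "D x (E x f) \<sigma> = 0"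
  using q_upd[OF assms, of 1 x] q_upd[OF assms, of "-1" x] by (simp add: D_def E_def)

lemma q_influence_upd:
  assumes "\<sigma> \<in> space P"
  shows "\<bar>D y (q x) \<sigma>\<bar> \<le> b * of_bool (y \<in> N x)"
proof -
  have "card {z \<in> N x. (\<sigma>(y := 1)) z \<noteq> (\<sigma>(y := -1)) z} = card (if y \<in> N x then {y} else {})"
    by (rule arg_cong[where f = card]) auto
  also have "real \<dots> = of_bool (y \<in> N x)" by simp
  finally have "real (card {z \<in> N x. (\<sigma>(y := 1)) z \<noteq> (\<sigma>(y := -1)) z}) = of_bool (y \<in> N x)" .
  moreover have "\<sigma>(y := 1) \<in> space P" "\<sigma>(y := -1) \<in> space P" using assms by auto
  ultimately show ?thesis using q_influence[of "\<sigma>(y := 1)" "\<sigma>(y := -1)" x] by (metis D_def)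
qed

text \<open>A discrete product rule: exchanging \<open>D y\<close> and \<open>E x\<close> leaves a
  term where \<open>D y\<close> acts on \<open>q x\<close>, which vanishes unless \<open>y\<close>
  is a neighbour of \<open>x\<close>. The square root dominates the gradient at either pinned spin
  at \<open>y\<close>, and the integral of its square is controlled by
  \<open>integral_pinned\<close>.\<close>

lemma D_E_bound:
  assumes "\<sigma> \<in> space P" "y \<noteq> x"
  shows "\<bar>D y (E x f) \<sigma>\<bar> \<le> \<bar>E x (D y f) \<sigma>\<bar> +
    b * of_bool (y \<in> N x) * sqrt ((D x f (\<sigma>(y := 1)))\<^sup>2 + (D x f (\<sigma>(y := -1)))\<^sup>2)"
proof -
  have s: "\<sigma> y = 1 \<or> \<sigma> y = -1" using assms by (auto simp: space_P)
  have tw: "\<sigma>(y := a, x := c) = \<sigma>(x := c, y := a)" for a c using assms(2) by (rule fun_upd_twist)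
  \<comment> \<open>\<open>E x (D y f)\<close> weighs both values of the spin at \<open>y\<close>
    with \<open>q x\<close> at \<sigma> itself, so the leftover gradient of \<open>f\<close> is
    taken where the spin at \<open>y\<close> is opposite.\<close>
  have "D y (E x f) \<sigma> - E x (D y f) \<sigma> = D y (q x) \<sigma> * D x f (\<sigma>(y := - \<sigma> y))"
    using s
  proof
    assume "\<sigma> y = 1"
    then have "\<sigma>(y := 1) = \<sigma>" by auto
    then have "q x \<sigma> = q x (\<sigma>(y := 1))" by simp
    then show ?thesis unfolding D_def E_def tw \<open>\<sigma> y = 1\<close>
      by (simp add: tw algebra_simps del: fun_upd_apply)
  next
    assume "\<sigma> y = -1"
    then have "\<sigma>(y := -1) = \<sigma>" by auto
    then have "q x \<sigma> = q x (\<sigma>(y := -1))" by simp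
    then show ?thesis unfolding D_def E_def tw \<open>\<sigma> y = -1\<close>
      by (simp add: tw algebra_simps del: fun_upd_apply)
  qed
  then have "\<bar>D y (E x f) \<sigma>\<bar> \<le> \<bar>E x (D y f) \<sigma>\<bar> + \<bar>D y (q x) \<sigma>\<bar> * \<bar>D x f (\<sigma>(y := - \<sigma> y))\<bar>"
    by (simp add: diff_eq_eq abs_triangle_ineq flip: abs_mult)
  also have "\<bar>D y (q x) \<sigma>\<bar> * \<bar>D x f (\<sigma>(y := - \<sigma> y))\<bar> \<le>
    (b * of_bool (y \<in> N x)) * sqrt ((D x f (\<sigma>(y := 1)))\<^sup>2 + (D x f (\<sigma>(y := -1)))\<^sup>2)"
  proof (rule mult_mono)
    show "\<bar>D x f (\<sigma>(y := - \<sigma> y))\<bar> \<le> sqrt ((D x f (\<sigma>(y := 1)))\<^sup>2 + (D x f (\<sigma>(y := -1)))\<^sup>2)"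
      using s by (auto intro!: real_le_rsqrt)
  qed (use q_influence_upd[OF assms(1)] b_nonneg in auto)
  finally show ?thesis by simp
qed

lemma nrm_D_E_self:
  shows "nrm (D x (E x f)) = 0"
proof -
  have "(\<integral>\<sigma>. (D x (E x f) \<sigma>)\<^sup>2 \<partial>P) = (\<integral>\<sigma>. 0 \<partial>P)"
    by (rule Bochner_Integration.integral_cong) (auto simp: D_E_self)
  then show ?thesis by (simp add: l2norm_def)
qed

lemma nrm_D_E:
  assumes "L2 f" "y \<noteq> x"
  shows "nrm (D y (E x f)) \<le> nrm (D y f) + 2 * b * of_bool (y \<in> N x) * nrm (D x f)"
proof -
  define R where "R \<sigma> = sqrt ((D x f (\<sigma>(y := 1)))\<^sup>2 + (D x f (\<sigma>(y := -1)))\<^sup>2)" for \<sigma>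
  define B where "B = b * of_bool (y \<in> N x)"
  have B: "B \<ge> 0" using b_nonneg by (simp add: B_def)
  have [measurable]: "f \<in> borel_measurable P" using assms(1) by (rule sq_integrableD)
  have Dx: "L2 (D x f)" and Dy: "L2 (D y f)" using assms by (auto intro: L2_D)
  have iD: "integrable P (\<lambda>\<sigma>. (D x f \<sigma>)\<^sup>2)" using Dx by (simp add: sq_integrable_def)
  have nn: "0 \<le> (D x f \<sigma>)\<^sup>2" for \<sigma> by simp
  note pin = integral_pinned[OF iD nn, of y]
  have R2: "(R \<sigma>)\<^sup>2 = (D x f (\<sigma>(y := 1)))\<^sup>2 + (D x f (\<sigma>(y := -1)))\<^sup>2" for \<sigma>
    by (simp add: R_def)
  have [measurable]: "(\<lambda>\<sigma>. D x f (\<sigma>(y := 1))) \<in> borel_measurable P"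
    "(\<lambda>\<sigma>. D x f (\<sigma>(y := -1))) \<in> borel_measurable P"
    by (auto intro!: measurable_upd_comp)
  have [measurable]: "R \<in> borel_measurable P" unfolding R_def[abs_def] by measurable
  have R: "L2 R" using pin by (simp add: sq_integrable_def R2)
  \<comment> \<open>Pinning the spin at \<open>y\<close> costs a factor 3 in the square; rounding 3
    up to 4 produces the factor 2 in front of \<open>b\<close>.\<close>
  have "nrm R \<le> sqrt (2\<^sup>2 * (nrm (D x f))\<^sup>2)"
    unfolding l2norm_square unfolding l2norm_def R2
  proof (rule real_sqrt_le_mono)
    have "0 \<le> (\<integral>\<sigma>. (D x f \<sigma>)\<^sup>2 \<partial>P)" by simp
    then have "3 * (\<integral>\<sigma>. (D x f \<sigma>)\<^sup>2 \<partial>P) \<le> 2\<^sup>2 * (\<integral>\<sigma>. (D x f \<sigma>)\<^sup>2 \<partial>P)" by (intro mult_right_mono) auto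
    with pin(3) show "(\<integral>\<sigma>. (D x f (\<sigma>(y := 1)))\<^sup>2 + (D x f (\<sigma>(y := -1)))\<^sup>2 \<partial>P)
        \<le> 2\<^sup>2 * (\<integral>\<sigma>. (D x f \<sigma>)\<^sup>2 \<partial>P)" by (rule order_trans)
  qed
  also have "\<dots> = 2 * nrm (D x f)" by (simp add: real_sqrt_mult)
  finally have nR: "nrm R \<le> 2 * nrm (D x f)" .
  have L: "L2 (\<lambda>\<sigma>. \<bar>E x (D y f) \<sigma>\<bar>)" "L2 (\<lambda>\<sigma>. B * R \<sigma>)"
    using L2_E(1)[OF Dy, of x] R by (auto intro: sq_integrable_abs sq_integrable_cmult)
  have "nrm (D y (E x f)) \<le> nrm (\<lambda>\<sigma>. \<bar>E x (D y f) \<sigma>\<bar> + B * R \<sigma>)"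
  proof (rule l2norm_mono)
    show "L2 (\<lambda>\<sigma>. \<bar>E x (D y f) \<sigma>\<bar> + B * R \<sigma>)" using L by (rule sq_integrable_add)
    fix \<sigma> assume "\<sigma> \<in> space P"
    from D_E_bound[OF this assms(2), of f]
    show "\<bar>D y (E x f) \<sigma>\<bar> \<le> \<bar>\<bar>E x (D y f) \<sigma>\<bar> + B * R \<sigma>\<bar>" by (simp add: B_def R_def)
  qed simp
  also have "\<dots> \<le> nrm (\<lambda>\<sigma>. \<bar>E x (D y f) \<sigma>\<bar>) + nrm (\<lambda>\<sigma>. B * R \<sigma>)"
    using L by (rule l2norm_triangle)
  also have "nrm (\<lambda>\<sigma>. \<bar>E x (D y f) \<sigma>\<bar>) = nrm (E x (D y f))" by (simp add: l2norm_def)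
  also have "\<dots> \<le> nrm (D y f)" by (rule L2_E(2)[OF Dy])
  also have "nrm (\<lambda>\<sigma>. B * R \<sigma>) \<le> B * (2 * nrm (D x f))"
    using B nR by (simp add: l2norm_cmult mult_left_mono)
  finally show ?thesis by (simp add: B_def mult_ac)
qed

text \<open>By stationarity the integrand may be replaced by its resampled version, which is the
  conditional covariance of \<open>f\<close> and \<open>g\<close> at \<open>x\<close>:
  \<open>q * (1 - q)\<close> times the product of the gradients. Bounding \<open>q * (1 - q)\<close>
  by 1 and using Cauchy-Schwarz finishes.\<close>

lemma covariance_step:
  assumes "L2 f" "L2 g"
  shows "(\<integral>\<sigma>. f \<sigma> * g \<sigma> \<partial>P) - (\<integral>\<sigma>. E x f \<sigma> * g \<sigma> \<partial>P) \<le> nrm (D x f) * nrm (D x g)"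
proof -
  have Ef: "L2 (E x f)" using L2_E[OF assms(1)] by simp
  have i: "integrable P (\<lambda>\<sigma>. f \<sigma> * g \<sigma>)" "integrable P (\<lambda>\<sigma>. E x f \<sigma> * g \<sigma>)"
    using assms Ef by (auto intro: integrable_mult_sq)
  have "(\<integral>\<sigma>. f \<sigma> * g \<sigma> \<partial>P) - (\<integral>\<sigma>. E x f \<sigma> * g \<sigma> \<partial>P) = (\<integral>\<sigma>. f \<sigma> * g \<sigma> - E x f \<sigma> * g \<sigma> \<partial>P)"
    using i by simp
  also have "\<dots> = (\<integral>\<sigma>. E x (\<lambda>\<sigma>. f \<sigma> * g \<sigma> - E x f \<sigma> * g \<sigma>) \<sigma> \<partial>P)"
    using i by (intro integral_E(2)[symmetric]) auto
  also have "\<dots> \<le> (\<integral>\<sigma>. \<bar>D x f \<sigma>\<bar> * \<bar>D x g \<sigma>\<bar> \<partial>P)"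
  proof (rule integral_mono)
    show "integrable P (E x (\<lambda>\<sigma>. f \<sigma> * g \<sigma> - E x f \<sigma> * g \<sigma>))"
      using i by (intro integral_E(1)) auto
    show "integrable P (\<lambda>\<sigma>. \<bar>D x f \<sigma>\<bar> * \<bar>D x g \<sigma>\<bar>)"
      using assms by (intro integrable_mult_sq sq_integrable_abs L2_D)
    fix \<sigma> assume s: "\<sigma> \<in> space P"
    have "E x (\<lambda>\<sigma>. f \<sigma> * g \<sigma> - E x f \<sigma> * g \<sigma>) \<sigma> = (q x \<sigma> * (1 - q x \<sigma>)) * (D x f \<sigma> * D x g \<sigma>)"
      using q_upd[OF s, of 1 x] q_upd[OF s, of "-1" x]
      by (simp add: E_def D_def algebra_simps)
    also have "\<dots> \<le> \<bar>(q x \<sigma> * (1 - q x \<sigma>)) * (D x f \<sigma> * D x g \<sigma>)\<bar>" by (rule abs_ge_self)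
    also have "\<dots> = (q x \<sigma> * (1 - q x \<sigma>)) * (\<bar>D x f \<sigma>\<bar> * \<bar>D x g \<sigma>\<bar>)"
      using q_bounds[OF s, of x] by (simp add: abs_mult)
    also have "\<dots> \<le> 1 * (\<bar>D x f \<sigma>\<bar> * \<bar>D x g \<sigma>\<bar>)"
      using q_bounds[OF s, of x] by (intro mult_right_mono mult_le_one) auto
    finally show "E x (\<lambda>\<sigma>. f \<sigma> * g \<sigma> - E x f \<sigma> * g \<sigma>) \<sigma> \<le> \<bar>D x f \<sigma>\<bar> * \<bar>D x g \<sigma>\<bar>" by simp
  qed
  also have "\<dots> \<le> nrm (\<lambda>\<sigma>. \<bar>D x f \<sigma>\<bar>) * nrm (\<lambda>\<sigma>. \<bar>D x g \<sigma>\<bar>)"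
    using assms
    by (intro order_trans[OF abs_ge_self l2norm_Cauchy_Schwarz] sq_integrable_abs L2_D)
  also have "\<dots> = nrm (D x f) * nrm (D x g)" by (simp add: l2norm_def)
  finally show ?thesis .
qed

section \<open>Sequences of updates; the head of the list acts first\<close>

lemma L2_fold_E:
  assumes "L2 f"
  shows "L2 (fold E xs f)" "nrm (fold E xs f) \<le> nrm f"
proof -
  have "L2 (fold E xs f) \<and> nrm (fold E xs f) \<le> nrm f"
    using assms
  proof (induction xs arbitrary: f)
    case (Cons x xs)
    from Cons.IH[OF L2_E(1)[OF Cons.prems]] L2_E(2)[OF Cons.prems, of x]
    show ?case by (auto intro: order_trans)
  qed simp
  then show "L2 (fold E xs f)" "nrm (fold E xs f) \<le> nrm f" by auto
qed

lemma fold_E_diff: "fold E xs (\<lambda>\<sigma>. f \<sigma> - g \<sigma>) = (\<lambda>\<sigma>. fold E xs f \<sigma> - fold E xs g \<sigma>)"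
proof (induction xs arbitrary: f g)
  case (Cons x xs)
  have "E x (\<lambda>\<sigma>. f \<sigma> - g \<sigma>) = (\<lambda>\<sigma>. E x f \<sigma> - E x g \<sigma>)"
    by (auto simp: E_def algebra_simps)
  then show ?case using Cons.IH by simp
qed simp

text \<open>\<open>U y\<close> is the total oscillation removed at site \<open>y\<close> along the sequence of updates. It is
  at most the initial oscillation at \<open>y\<close> plus what earlier updates of the neighbours of \<open>y\<close>
  transferred to \<open>y\<close>.\<close>

lemma covariance_along_updates:
  assumes "L2 f" "L2 g"
  shows "\<exists>U. (\<forall>y. 0 \<le> U y) \<and> (\<forall>y. y \<notin> set xs \<longrightarrow> U y = 0) \<and>
    (\<forall>y. U y \<le> nrm (D y f) + 2 * b * (\<Sum>z\<in>N y. U z)) \<and>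
    (\<integral>\<sigma>. f \<sigma> * g \<sigma> \<partial>P) - (\<integral>\<sigma>. fold E xs f \<sigma> * g \<sigma> \<partial>P) \<le> (\<Sum>y\<in>set xs. U y * nrm (D y g))"
  using assms(1)
proof (induction xs arbitrary: f)
  case Nil
  then show ?case by (intro exI[of _ "\<lambda>_. 0"]) auto
next
  case (Cons x xs)
  define a where "a = nrm (D x f)"
  have a: "a \<ge> 0" by (simp add: a_def)
  from Cons.IH[OF L2_E(1)[OF Cons.prems, of x]] obtain U where
    U: "\<And>y. 0 \<le> U y" "\<And>y. y \<notin> set xs \<Longrightarrow> U y = 0"
    "\<And>y. U y \<le> nrm (D y (E x f)) + 2 * b * (\<Sum>z\<in>N y. U z)"
    "(\<integral>\<sigma>. E x f \<sigma> * g \<sigma> \<partial>P) - (\<integral>\<sigma>. fold E xs (E x f) \<sigma> * g \<sigma> \<partial>P) \<le> (\<Sum>y\<in>set xs. U y * nrm (D y g))"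
    by blast
  \<comment> \<open>The first update removes \<open>a\<close> at \<open>x\<close>, on top of what
    the later updates remove there.\<close>
  define V where "V y = U y + (if y = x then a else 0)" for y
  have sumV: "(\<Sum>z\<in>N y. V z) = (\<Sum>z\<in>N y. U z) + of_bool (x \<in> N y) * a" for y
    using N_finite[of y] by (simp add: V_def sum.distrib sum.delta')
  have "V y \<le> nrm (D y f) + 2 * b * (\<Sum>z\<in>N y. V z)" for y
  proof (cases "y = x")
    \<comment> \<open>After the first update the gradient at \<open>x\<close> has norm 0, so
      \<open>U x\<close> is bounded by the neighbour sum alone, and the initial oscillation at
      \<open>x\<close> pays for \<open>a\<close>.\<close>
    case True
    have "x \<notin> N x" by (rule N_irrefl)
    then show ?thesis unfolding sumV using U(3)[of x] True by (simp add: V_def nrm_D_E_self a_def)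
  next
    case False
    \<comment> \<open>What the first update transfers to a neighbour \<open>y\<close> is exactly
      what the added \<open>a\<close> in \<open>V x\<close> contributes to the neighbour sum of
      \<open>y\<close>.\<close>
    have "U y \<le> nrm (D y (E x f)) + 2 * b * (\<Sum>z\<in>N y. U z)" by (rule U(3))
    also have "nrm (D y (E x f)) \<le> nrm (D y f) + 2 * b * of_bool (y \<in> N x) * a"
      unfolding a_def by (rule nrm_D_E[OF Cons.prems False])
    finally show ?thesis unfolding sumV using False N_sym[of y x] by (simp add: V_def algebra_simps)
  qed
  moreover have "(\<integral>\<sigma>. f \<sigma> * g \<sigma> \<partial>P) - (\<integral>\<sigma>. fold E (x # xs) f \<sigma> * g \<sigma> \<partial>P)
      \<le> (\<Sum>y\<in>set (x # xs). V y * nrm (D y g))"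
  proof -
    have "(\<Sum>y\<in>set (x # xs). V y * nrm (D y g)) =
      (\<Sum>y\<in>set (x # xs). U y * nrm (D y g)) +
      (\<Sum>y\<in>set (x # xs). if y = x then a * nrm (D y g) else 0)"
      unfolding sum.distrib[symmetric] by (rule sum.cong) (auto simp: V_def algebra_simps)
    also have "(\<Sum>y\<in>set (x # xs). if y = x then a * nrm (D y g) else 0) = a * nrm (D x g)"
      by (subst sum.delta) auto
    also have "(\<Sum>y\<in>set (x # xs). U y * nrm (D y g)) = (\<Sum>y\<in>set xs. U y * nrm (D y g))"
      by (rule sum.mono_neutral_right) (use U(2) in auto)
    finally show ?thesis
      using U(4) covariance_step[OF Cons.prems assms(2), of x] by (simp add: a_def)
  qed
  moreover have "0 \<le> V y" for y using U(1)[of y] a by (simp add: V_def)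
  moreover have "V y = 0" if "y \<notin> set (x # xs)" for y using U(2)[of y] that by (simp add: V_def)
  ultimately show ?case by (intro exI[of _ V]) auto
qed

text \<open>The adjacency form on \<open>S\<close> is at most \<open>m\<close> times the squared
  norm. Pairing the inequality for \<open>U\<close> with \<open>U\<close> itself therefore gives
  \<open>k * W \<le> Q\<close>; combined with Cauchy-Schwarz for \<open>Q\<close>, this eliminates
  \<open>U\<close>.\<close>

lemma removed_oscillation_bound:
  fixes U a :: "'a \<Rightarrow> real"
  assumes "finite S" "\<And>y. 0 \<le> U y" "\<And>y. y \<notin> S \<Longrightarrow> U y = 0"
    and U: "\<And>y. U y \<le> a y + 2 * b * (\<Sum>z\<in>N y. U z)"
  shows "(\<Sum>y\<in>S. U y * a y) \<le> (\<Sum>y\<in>S. (a y)\<^sup>2) / (1 - 2 * b * real m)"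
proof -
  define Q where "Q = (\<Sum>y\<in>S. U y * a y)"
  define W where "W = (\<Sum>y\<in>S. (U y)\<^sup>2)"
  define A where "A = (\<Sum>y\<in>S. (a y)\<^sup>2)"
  define k where "k = 1 - 2 * b * real m"
  have k: "k > 0" using b_small by (simp add: k_def)
  have W0: "W \<ge> 0" and A0: "A \<ge> 0" by (auto simp: W_def A_def intro: sum_nonneg)
  let ?i = "\<lambda>y z. of_bool (z \<in> N y) :: real"
  have deg: "(\<Sum>z\<in>S. ?i y z) \<le> real m" for y
  proof -
    have "(\<Sum>z\<in>S. ?i y z) = real (card (S \<inter> N y))"
      using assms(1) by (simp add: sum.If_cases of_bool_def Int_def)
    also have "card (S \<inter> N y) \<le> card (N y)" using N_finite by (intro card_mono) auto
    also have "\<dots> \<le> m" by (rule N_card)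
    finally show ?thesis by simp
  qed
  have nb: "(\<Sum>z\<in>N y. U z) = (\<Sum>z\<in>S. ?i y z * U z)" for y
  proof -
    have "(\<Sum>z\<in>N y. U z) = (\<Sum>z\<in>N y \<inter> S. U z)"
      using N_finite assms(3) by (intro sum.mono_neutral_right) auto
    also have "\<dots> = (\<Sum>z\<in>S. ?i y z * U z)"
      using assms(1) by (simp add: sum.inter_restrict[symmetric] of_bool_def if_distrib if_distribR Int_commute cong: if_cong)
    finally show ?thesis .
  qed
  \<comment> \<open>Each product \<open>2 * (U y * U z)\<close> is split into squares; by the
    symmetry of \<open>N\<close> both resulting double sums are row sums of the adjacency matrix,
    hence at most \<open>m * W\<close>.\<close>
  have "2 * (\<Sum>y\<in>S. U y * (\<Sum>z\<in>N y. U z)) = (\<Sum>y\<in>S. \<Sum>z\<in>S. ?i y z * (2 * (U y * U z)))"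
    unfolding nb by (simp add: sum_distrib_left mult_ac)
  also have "\<dots> \<le> (\<Sum>y\<in>S. \<Sum>z\<in>S. ?i y z * ((U y)\<^sup>2 + (U z)\<^sup>2))"
    using sum_squares_bound by (intro sum_mono mult_left_mono) (auto simp: mult.assoc)
  also have "\<dots> = (\<Sum>y\<in>S. \<Sum>z\<in>S. ?i y z * (U y)\<^sup>2) + (\<Sum>y\<in>S. \<Sum>z\<in>S. ?i y z * (U z)\<^sup>2)"
    by (simp add: distrib_left sum.distrib)
  also have "(\<Sum>y\<in>S. \<Sum>z\<in>S. ?i y z * (U z)\<^sup>2) = (\<Sum>z\<in>S. \<Sum>y\<in>S. ?i z y * (U z)\<^sup>2)"
    using N_sym by (subst sum.swap) (intro sum.cong, auto)
  also have "(\<Sum>y\<in>S. \<Sum>z\<in>S. ?i y z * (U y)\<^sup>2) = (\<Sum>y\<in>S. (\<Sum>z\<in>S. ?i y z) * (U y)\<^sup>2)"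
    by (simp add: sum_distrib_right)
  also have "\<dots> + \<dots> \<le> real m * W + real m * W"
    unfolding W_def sum_distrib_left using deg by (intro add_mono sum_mono mult_right_mono) auto
  finally have UU: "(\<Sum>y\<in>S. U y * (\<Sum>z\<in>N y. U z)) \<le> real m * W" by linarith
  have "W \<le> (\<Sum>y\<in>S. U y * (a y + 2 * b * (\<Sum>z\<in>N y. U z)))"
    unfolding W_def power2_eq_square using assms(2) U by (intro sum_mono mult_left_mono) auto
  also have "\<dots> = Q + 2 * b * (\<Sum>y\<in>S. U y * (\<Sum>z\<in>N y. U z))"
    by (simp add: Q_def sum.distrib sum_distrib_left algebra_simps)
  also have "\<dots> \<le> Q + 2 * b * (real m * W)"
    using UU b_nonneg by (intro add_left_mono mult_left_mono) auto
  finally have kW: "k * W \<le> Q" by (simp add: k_def algebra_simps)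
  then have Q0: "Q \<ge> 0" using k W0 by (meson mult_nonneg_nonneg less_imp_le order_trans)
  \<comment> \<open>Cauchy-Schwarz bounds the square of \<open>Q\<close> by \<open>W * A\<close>,
    and \<open>W \<le> Q / k\<close>; one factor \<open>Q\<close> then cancels, the case
    \<open>Q = 0\<close> being trivial.\<close>
  have "Q\<^sup>2 \<le> W * A" unfolding Q_def W_def A_def by (rule Cauchy_Schwarz_ineq_sum)
  then have "k * Q\<^sup>2 \<le> (k * W) * A" using k by simp
  also have "\<dots> \<le> Q * A" using kW A0 by (rule mult_right_mono)
  finally have "Q * (k * Q) \<le> Q * A" by (simp add: power2_eq_square mult_ac)
  then have "k * Q \<le> A"
    using Q0 A0 k by (cases "Q = 0") auto
  then show ?thesis using k by (simp add: Q_def A_def k_def field_simps)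
qed

section \<open>Contraction of local functions\<close>

text \<open>Lipschitz continuity for a Hamming distance weighted by \<open>v\<close>. The weights
  vanish off \<open>S\<close>, so that sums may be taken over larger sets, and
  \<open>sum v S\<close> bounds the total oscillation.\<close>

definition local_lipschitz :: "'a set \<Rightarrow> ('a \<Rightarrow> real) \<Rightarrow> (('a \<Rightarrow> int) \<Rightarrow> real) \<Rightarrow> bool" where
  "local_lipschitz S v g \<longleftrightarrow> finite S \<and> (\<forall>y. 0 \<le> v y) \<and> (\<forall>y. y \<notin> S \<longrightarrow> v y = 0) \<and>
    (\<forall>\<sigma>\<in>space P. \<forall>\<tau>\<in>space P. \<bar>g \<sigma> - g \<tau>\<bar> \<le> (\<Sum>y\<in>S. v y * of_bool (\<sigma> y \<noteq> \<tau> y)))"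

text \<open>Give both configurations the same new spin at \<open>x\<close> as far as their
  conditional laws agree: the weight at \<open>x\<close> disappears, and the mismatch of the laws,
  at most \<open>b\<close> per disagreeing neighbour, costs \<open>v x\<close>.\<close>

lemma local_lipschitz_E:
  assumes "local_lipschitz S v g"
  shows "local_lipschitz (S \<union> N x)
    (\<lambda>y. (if y = x then 0 else v y) + b * v x * of_bool (y \<in> N x)) (E x g)"
proof -
  let ?w = "\<lambda>y. (if y = x then 0 else v y) + b * v x * of_bool (y \<in> N x)"
  have fin: "finite S" and v0: "\<And>y. 0 \<le> v y" and vS: "\<And>y. y \<notin> S \<Longrightarrow> v y = 0"
    and g: "\<And>\<sigma> \<tau>. \<sigma> \<in> space P \<Longrightarrow> \<tau> \<in> space P \<Longrightarrow> \<bar>g \<sigma> - g \<tau>\<bar> \<le> (\<Sum>y\<in>S. v y * of_bool (\<sigma> y \<noteq> \<tau> y))"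
    using assms by (auto simp: local_lipschitz_def)
  have "\<bar>E x g \<sigma> - E x g \<tau>\<bar> \<le> (\<Sum>y\<in>S \<union> N x. ?w y * of_bool (\<sigma> y \<noteq> \<tau> y))"
    if s: "\<sigma> \<in> space P" and t: "\<tau> \<in> space P" for \<sigma> \<tau>
  proof -
    define T where "T = (\<Sum>y\<in>S. (if y = x then 0 else v y) * of_bool (\<sigma> y \<noteq> \<tau> y))"
    have same: "\<bar>g (\<sigma>(x := c)) - g (\<tau>(x := c))\<bar> \<le> T" if "c \<in> {-1, 1}" for c
    proof -
      have "\<bar>g (\<sigma>(x := c)) - g (\<tau>(x := c))\<bar> \<le> (\<Sum>y\<in>S. v y * of_bool ((\<sigma>(x := c)) y \<noteq> (\<tau>(x := c)) y))"
        using that s t by (intro g upd_space)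
      also have "\<dots> = T" unfolding T_def by (rule sum.cong) auto
      finally show ?thesis .
    qed
    have diff: "\<bar>g (\<tau>(x := 1)) - g (\<tau>(x := -1))\<bar> \<le> v x"
    proof -
      have "\<bar>g (\<tau>(x := 1)) - g (\<tau>(x := -1))\<bar> \<le> (\<Sum>y\<in>S. v y * of_bool ((\<tau>(x := 1)) y \<noteq> (\<tau>(x := -1)) y))"
        using t by (intro g upd_space) auto
      also have "\<dots> = (\<Sum>y\<in>S. if y = x then v y else 0)" by (rule sum.cong) auto
      also have "\<dots> \<le> v x" using fin v0[of x] by (simp add: sum.delta)
      finally show ?thesis .
    qed
    have q: "0 \<le> q x \<sigma>" "0 \<le> 1 - q x \<sigma>" using q_bounds[OF s, of x] by auto
    \<comment> \<open>The first two terms compare equal new spins under the law of \<sigma>; the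
      third accounts for the change of law on the fixed configuration \<tau>.\<close>
    have "E x g \<sigma> - E x g \<tau> = q x \<sigma> * (g (\<sigma>(x := 1)) - g (\<tau>(x := 1)))
        + (1 - q x \<sigma>) * (g (\<sigma>(x := -1)) - g (\<tau>(x := -1)))
        + (q x \<sigma> - q x \<tau>) * (g (\<tau>(x := 1)) - g (\<tau>(x := -1)))"
      by (simp add: E_def algebra_simps)
    then have "\<bar>E x g \<sigma> - E x g \<tau>\<bar> \<le> \<bar>q x \<sigma> * (g (\<sigma>(x := 1)) - g (\<tau>(x := 1)))\<bar>
        + \<bar>(1 - q x \<sigma>) * (g (\<sigma>(x := -1)) - g (\<tau>(x := -1)))\<bar>
        + \<bar>(q x \<sigma> - q x \<tau>) * (g (\<tau>(x := 1)) - g (\<tau>(x := -1)))\<bar>"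
      by linarith
    also have "\<dots> \<le> q x \<sigma> * T + (1 - q x \<sigma>) * T + (b * real (card {y \<in> N x. \<sigma> y \<noteq> \<tau> y})) * v x"
      using same[of 1] same[of "-1"] diff q q_influence[OF s t, of x] b_nonneg
      unfolding abs_mult by (intro add_mono mult_mono) auto
    also have "\<dots> = T + b * v x * real (card {y \<in> N x. \<sigma> y \<noteq> \<tau> y})"
      by (simp add: algebra_simps)
    also have "T = (\<Sum>y\<in>S \<union> N x. (if y = x then 0 else v y) * of_bool (\<sigma> y \<noteq> \<tau> y))"
      unfolding T_def using fin N_finite vS by (intro sum.mono_neutral_left) auto
    also have "real (card {y \<in> N x. \<sigma> y \<noteq> \<tau> y}) = (\<Sum>y\<in>N x. of_bool (\<sigma> y \<noteq> \<tau> y))"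
      using N_finite by (simp add: sum.If_cases of_bool_def Int_def)
    also have "\<dots> = (\<Sum>y\<in>S \<union> N x. of_bool (y \<in> N x) * of_bool (\<sigma> y \<noteq> \<tau> y))"
      using fin N_finite by (intro sum.mono_neutral_cong_left) auto
    finally show ?thesis by (simp add: sum_distrib_left sum.distrib distrib_right mult.assoc)
  qed
  then show ?thesis
    using fin N_finite v0 vS b_nonneg by (auto simp: local_lipschitz_def)
qed

text \<open>The potential on the right discounts by \<open>c = b * m\<close> the sites still
  awaiting their update. Updating \<open>x\<close> trades the discounted \<open>c * v x\<close> for
  at most \<open>m\<close> shares \<open>b * v x\<close>, each counted with a factor at most 1, so
  the potential does not grow.\<close>

lemma local_lipschitz_sweep:
  assumes "local_lipschitz S v g" "distinct xs"
  shows "\<exists>S' v'. local_lipschitz S' v' (fold E xs g) \<and>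
    sum v' S' \<le> (\<Sum>y\<in>S. (if y \<in> set xs then b * real m else 1) * v y)"
  using assms
proof (induction xs arbitrary: S v g)
  case Nil
  then show ?case by (intro exI[of _ S] exI[of _ v]) simp
next
  case (Cons x xs)
  define c where "c = b * real m"
  have c: "0 \<le> c" "c \<le> 1" using b_nonneg b_small by (auto simp: c_def)
  have fin: "finite S" and v0: "\<And>y. 0 \<le> v y" and vS: "\<And>y. y \<notin> S \<Longrightarrow> v y = 0"
    using Cons.prems by (auto simp: local_lipschitz_def)
  let ?w = "\<lambda>y. if y \<in> set xs then c else 1"
  let ?v = "\<lambda>y. (if y = x then 0 else v y) + b * v x * of_bool (y \<in> N x)"
  have "(\<Sum>y\<in>S \<union> N x. ?w y * ?v y) =
    (\<Sum>y\<in>S \<union> N x. ?w y * (if y = x then 0 else v y)) +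
    (\<Sum>y\<in>S \<union> N x. ?w y * (b * v x * of_bool (y \<in> N x)))"
    by (simp add: distrib_left sum.distrib)
  also have "(\<Sum>y\<in>S \<union> N x. ?w y * (if y = x then 0 else v y)) = (\<Sum>y\<in>S. ?w y * (if y = x then 0 else v y))"
    using fin N_finite vS by (intro sum.mono_neutral_right) auto
  also have "(\<Sum>y\<in>S \<union> N x. ?w y * (b * v x * of_bool (y \<in> N x))) = (\<Sum>y\<in>N x. ?w y * (b * v x))"
    using fin N_finite by (intro sum.mono_neutral_cong_right) auto
  also have "\<dots> \<le> (\<Sum>y\<in>N x. b * v x)"
    using c b_nonneg v0 by (intro sum_mono mult_left_le_one_le mult_nonneg_nonneg) auto
  also have "\<dots> = b * v x * real (card (N x))" by simp
  also have "\<dots> \<le> b * v x * real m"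
    using N_card b_nonneg v0 by (intro mult_left_mono) auto
  also have "b * v x * real m = (\<Sum>y\<in>S. if y = x then c * v y else 0)"
    using fin vS[of x] by (simp add: sum.delta c_def)
  also have "(\<Sum>y\<in>S. ?w y * (if y = x then 0 else v y)) + (\<Sum>y\<in>S. if y = x then c * v y else 0)
    = (\<Sum>y\<in>S. (if y \<in> set (x # xs) then c else 1) * v y)"
    unfolding sum.distrib[symmetric] by (rule sum.cong) auto
  finally have le: "(\<Sum>y\<in>S \<union> N x. ?w y * ?v y) \<le> (\<Sum>y\<in>S. (if y \<in> set (x # xs) then c else 1) * v y)"
    by simp
  have "distinct xs" using Cons.prems by simp
  from Cons.IH[OF local_lipschitz_E[OF Cons.prems(1), of x] this]
  obtain S' v' where *: "local_lipschitz S' v' (fold E xs (E x g))"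
    "sum v' S' \<le> (\<Sum>y\<in>S \<union> N x. ?w y * ?v y)" unfolding c_def by blast
  show ?case
    using * le unfolding c_def by (intro exI[of _ S'] exI[of _ v']) auto
qed

lemma local_lipschitz_sweeps:
  assumes "local_lipschitz S v g"
  shows "\<exists>xs S' v'. local_lipschitz S' v' (fold E xs g) \<and> sum v' S' \<le> (b * real m) ^ n * sum v S"
proof (induction n)
  case 0
  then show ?case using assms by (intro exI[of _ "[]"] exI[of _ S] exI[of _ v]) simp
next
  case (Suc n)
  then obtain xs T w where T: "local_lipschitz T w (fold E xs g)" "sum w T \<le> (b * real m) ^ n * sum v S"
    by blast
  have "finite T" using T(1) by (simp add: local_lipschitz_def)
  \<comment> \<open>The support grows with every sweep, so the next sweep enumerates the current
    support; then every weight receives the factor \<open>b * m\<close>.\<close>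
  then obtain ys where ys: "set ys = T" "distinct ys" using finite_distinct_list by blast
  from local_lipschitz_sweep[OF T(1) ys(2)] obtain S' v' where
    S': "local_lipschitz S' v' (fold E ys (fold E xs g))"
    "sum v' S' \<le> (\<Sum>y\<in>T. (if y \<in> set ys then b * real m else 1) * w y)" by blast
  have "(\<Sum>y\<in>T. (if y \<in> set ys then b * real m else 1) * w y) = b * real m * sum w T"
    unfolding sum_distrib_left by (rule sum.cong) (auto simp: ys)
  also have "\<dots> \<le> b * real m * ((b * real m) ^ n * sum v S)"
    using T(2) b_nonneg by (intro mult_left_mono) auto
  finally show ?case
    using S' by (intro exI[of _ "xs @ ys"] exI[of _ S'] exI[of _ v']) (simp add: mult_ac)
qed

text \<open>The sum of the weights bounds the oscillation over all of \<open>space P\<close>, and it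
  decays geometrically under sweeps because \<open>b * m < 1\<close>.\<close>

lemma local_nearly_constant:
  assumes "local_lipschitz S v g" "e > 0"
  shows "\<exists>xs. \<forall>\<sigma>\<in>space P. \<forall>\<tau>\<in>space P. \<bar>fold E xs g \<sigma> - fold E xs g \<tau>\<bar> \<le> e"
proof -
  have "(\<lambda>n. (b * real m) ^ n * sum v S) \<longlonglongrightarrow> 0 * sum v S"
    using b_nonneg b_small by (intro tendsto_intros LIMSEQ_power_zero) auto
  then have "\<forall>\<^sub>F n in sequentially. (b * real m) ^ n * sum v S < e"
    using assms(2) by (intro order_tendstoD) auto
  then obtain n where n: "(b * real m) ^ n * sum v S < e" by (auto simp: eventually_sequentially)
  from local_lipschitz_sweeps[OF assms(1), of n] obtain xs S' v' where
    *: "local_lipschitz S' v' (fold E xs g)" "sum v' S' \<le> (b * real m) ^ n * sum v S" by blast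
  show ?thesis
  proof (intro exI[of _ xs] ballI)
    fix \<sigma> \<tau> assume "\<sigma> \<in> space P" "\<tau> \<in> space P"
    then have "\<bar>fold E xs g \<sigma> - fold E xs g \<tau>\<bar> \<le> (\<Sum>y\<in>S'. v' y * of_bool (\<sigma> y \<noteq> \<tau> y))"
      using *(1) unfolding local_lipschitz_def by blast
    also have "\<dots> \<le> sum v' S'"
      using *(1) by (intro sum_mono) (auto simp: local_lipschitz_def)
    finally show "\<bar>fold E xs g \<sigma> - fold E xs g \<tau>\<bar> \<le> e" using * n by simp
  qed
qed

section \<open>Density of local functions\<close>

definition local :: "(('a \<Rightarrow> int) \<Rightarrow> real) \<Rightarrow> bool" where
  "local g \<longleftrightarrow> g \<in> borel_measurable P \<and> (\<exists>S v. local_lipschitz S v g)"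

definition approximable :: "(('a \<Rightarrow> int) \<Rightarrow> real) \<Rightarrow> bool" where
  "approximable f \<longleftrightarrow> (\<forall>e>0. \<exists>g. local g \<and> nrm (\<lambda>\<sigma>. f \<sigma> - g \<sigma>) < e)"

text \<open>A finite total weight bounds the distance to the value at one reference configuration,
  so the function is bounded.\<close>

lemma local_L2:
  assumes "local g" shows "L2 g"
proof -
  obtain S v where v: "local_lipschitz S v g" using assms by (auto simp: local_def)
  obtain \<sigma>0 where s0: "\<sigma>0 \<in> space P" using not_empty by blast
  have "\<bar>g \<sigma>\<bar> \<le> \<bar>g \<sigma>0\<bar> + sum v S" if "\<sigma> \<in> space P" for \<sigma>
  proof -
    have "\<bar>g \<sigma> - g \<sigma>0\<bar> \<le> (\<Sum>y\<in>S. v y * of_bool (\<sigma> y \<noteq> \<sigma>0 y))"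
      using v that s0 unfolding local_lipschitz_def by blast
    also have "\<dots> \<le> sum v S"
      using v by (intro sum_mono) (auto simp: local_lipschitz_def)
    finally show ?thesis by linarith
  qed
  then show ?thesis using assms by (intro sq_integrable_bounded) (auto simp: local_def)
qed

text \<open>The weights of \<open>g\<close> and \<open>h\<close> add up. Phrased for an arbitrary
  \<open>F\<close> to cover sums, differences and maxima together.\<close>

lemma local_combine:
  assumes "local g" "local h" "F \<in> borel_measurable P"
    and F: "\<And>\<sigma> \<tau>. \<sigma> \<in> space P \<Longrightarrow> \<tau> \<in> space P \<Longrightarrow> \<bar>F \<sigma> - F \<tau>\<bar> \<le> \<bar>g \<sigma> - g \<tau>\<bar> + \<bar>h \<sigma> - h \<tau>\<bar>"
  shows "local F"
proof -
  obtain S v T w where v: "local_lipschitz S v g" and w: "local_lipschitz T w h"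
    using assms(1,2) by (auto simp: local_def)
  have fin: "finite S" "finite T" and z: "\<And>y. y \<notin> S \<Longrightarrow> v y = 0" "\<And>y. y \<notin> T \<Longrightarrow> w y = 0"
    using v w by (auto simp: local_lipschitz_def)
  have "\<bar>F \<sigma> - F \<tau>\<bar> \<le> (\<Sum>y\<in>S \<union> T. (v y + w y) * of_bool (\<sigma> y \<noteq> \<tau> y))"
    if "\<sigma> \<in> space P" "\<tau> \<in> space P" for \<sigma> \<tau>
  proof -
    have "\<bar>F \<sigma> - F \<tau>\<bar> \<le> \<bar>g \<sigma> - g \<tau>\<bar> + \<bar>h \<sigma> - h \<tau>\<bar>" using that by (rule F)
    also have "\<bar>g \<sigma> - g \<tau>\<bar> \<le> (\<Sum>y\<in>S. v y * of_bool (\<sigma> y \<noteq> \<tau> y))"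
      using v that unfolding local_lipschitz_def by blast
    also have "\<dots> = (\<Sum>y\<in>S \<union> T. v y * of_bool (\<sigma> y \<noteq> \<tau> y))"
      using fin z by (intro sum.mono_neutral_left) auto
    also have "\<bar>h \<sigma> - h \<tau>\<bar> \<le> (\<Sum>y\<in>T. w y * of_bool (\<sigma> y \<noteq> \<tau> y))"
      using w that unfolding local_lipschitz_def by blast
    also have "\<dots> = (\<Sum>y\<in>S \<union> T. w y * of_bool (\<sigma> y \<noteq> \<tau> y))"
      using fin z by (intro sum.mono_neutral_left) auto
    finally show ?thesis by (simp add: distrib_right sum.distrib)
  qed
  then have "local_lipschitz (S \<union> T) (\<lambda>y. v y + w y) F"
    using v w by (auto simp: local_lipschitz_def)
  then show ?thesis using assms(3) by (auto simp: local_def)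
qed

lemma local_coordinate: "local (\<lambda>\<sigma>. indicator A (\<sigma> i))"
proof -
  have "local_lipschitz {i} (\<lambda>y. if y = i then 1 else 0) (\<lambda>\<sigma>. indicator A (\<sigma> i))"
    by (auto simp: local_lipschitz_def indicator_def Int_insert_left)
  moreover have "(\<lambda>\<sigma>. indicator A (\<sigma> i) :: real) \<in> borel_measurable P"
    by (rule measurable_compose[OF measurable_coord]) simp
  ultimately show ?thesis by (auto simp: local_def)
qed

lemma local_const: "local (\<lambda>_. a)"
  unfolding local_def local_lipschitz_def by (auto intro!: exI[of _ "{}"] exI[of _ "\<lambda>_. 0"])

lemma local_cmult:
  assumes "local g" shows "local (\<lambda>\<sigma>. a * g \<sigma>)"
proof -
  obtain S v where v: "local_lipschitz S v g" using assms by (auto simp: local_def)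
  have "\<bar>a * g \<sigma> - a * g \<tau>\<bar> \<le> (\<Sum>y\<in>S. \<bar>a\<bar> * v y * of_bool (\<sigma> y \<noteq> \<tau> y))"
    if "\<sigma> \<in> space P" "\<tau> \<in> space P" for \<sigma> \<tau>
  proof -
    have "\<bar>a * g \<sigma> - a * g \<tau>\<bar> = \<bar>a\<bar> * \<bar>g \<sigma> - g \<tau>\<bar>" by (simp add: abs_mult flip: right_diff_distrib)
    also have "\<dots> \<le> \<bar>a\<bar> * (\<Sum>y\<in>S. v y * of_bool (\<sigma> y \<noteq> \<tau> y))"
      by (rule mult_left_mono) (use v that in \<open>unfold local_lipschitz_def, blast, simp\<close>)
    finally show ?thesis by (simp only: sum_distrib_left mult.assoc)
  qed
  then have "local_lipschitz S (\<lambda>y. \<bar>a\<bar> * v y) (\<lambda>\<sigma>. a * g \<sigma>)"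
    using v unfolding local_lipschitz_def by auto
  moreover have "(\<lambda>\<sigma>. a * g \<sigma>) \<in> borel_measurable P" using assms by (auto simp: local_def)
  ultimately show ?thesis by (auto simp: local_def)
qed

lemma local_approximable: "local f \<Longrightarrow> approximable f"
  unfolding approximable_def by (auto intro!: exI[of _ f] simp: l2norm_def)

lemma approximable_cong:
  assumes "approximable f" "\<And>\<sigma>. \<sigma> \<in> space P \<Longrightarrow> f \<sigma> = g \<sigma>"
  shows "approximable g"
proof -
  have "nrm (\<lambda>\<sigma>. f \<sigma> - h \<sigma>) = nrm (\<lambda>\<sigma>. g \<sigma> - h \<sigma>)" for h
    by (rule l2norm_cong) (simp add: assms(2))
  then show ?thesis using assms(1) by (simp add: approximable_def)
qed

text \<open>Applying a map that is 1-Lipschitz in the sum metric to the local approximants adds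
  their \<open>L2\<close> errors. It is used with \<open>+\<close>, \<open>-\<close> and
  \<open>max\<close>, the last one for finite unions of events.\<close>

lemma approximable_combine:
  assumes f: "approximable f" "L2 f" and h: "approximable h" "L2 h"
    and meas: "\<And>u v. u \<in> borel_measurable P \<Longrightarrow> v \<in> borel_measurable P \<Longrightarrow> (\<lambda>\<sigma>. C (u \<sigma>) (v \<sigma>)) \<in> borel_measurable P"
    and C: "\<And>s t s' t' :: real. \<bar>C s t - C s' t'\<bar> \<le> \<bar>s - s'\<bar> + \<bar>t - t'\<bar>"
  shows "approximable (\<lambda>\<sigma>. C (f \<sigma>) (h \<sigma>))"
  unfolding approximable_def
proof (intro allI impI)
  fix e :: real assume "e > 0"
  then have e2: "e / 2 > 0" by simp
  obtain f' where f': "local f'" "nrm (\<lambda>\<sigma>. f \<sigma> - f' \<sigma>) < e / 2"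
    using f(1) e2 unfolding approximable_def by blast
  obtain h' where h': "local h'" "nrm (\<lambda>\<sigma>. h \<sigma> - h' \<sigma>) < e / 2"
    using h(1) e2 unfolding approximable_def by blast
  have [measurable]: "f \<in> borel_measurable P" "h \<in> borel_measurable P"
    using f h by (auto dest: sq_integrableD)
  have [measurable]: "f' \<in> borel_measurable P" "h' \<in> borel_measurable P"
    using f' h' by (auto simp: local_def)
  have m [measurable]: "(\<lambda>\<sigma>. C (f \<sigma>) (h \<sigma>)) \<in> borel_measurable P"
    "(\<lambda>\<sigma>. C (f' \<sigma>) (h' \<sigma>)) \<in> borel_measurable P"
    by (intro meas; measurable)+
  have d: "L2 (\<lambda>\<sigma>. \<bar>f \<sigma> - f' \<sigma>\<bar>)" "L2 (\<lambda>\<sigma>. \<bar>h \<sigma> - h' \<sigma>\<bar>)"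
    using sq_integrable_abs[OF sq_integrable_diff[OF f(2) local_L2[OF f'(1)]]]
      sq_integrable_abs[OF sq_integrable_diff[OF h(2) local_L2[OF h'(1)]]] by auto
  have "local (\<lambda>\<sigma>. C (f' \<sigma>) (h' \<sigma>))"
    using f'(1) h'(1) m(2) C by (rule local_combine)
  moreover have "nrm (\<lambda>\<sigma>. C (f \<sigma>) (h \<sigma>) - C (f' \<sigma>) (h' \<sigma>)) < e"
  proof -
    have "nrm (\<lambda>\<sigma>. C (f \<sigma>) (h \<sigma>) - C (f' \<sigma>) (h' \<sigma>)) \<le> nrm (\<lambda>\<sigma>. \<bar>f \<sigma> - f' \<sigma>\<bar> + \<bar>h \<sigma> - h' \<sigma>\<bar>)"
    proof (rule l2norm_mono[OF sq_integrable_add[OF d]])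
      show "\<bar>C (f \<sigma>) (h \<sigma>) - C (f' \<sigma>) (h' \<sigma>)\<bar> \<le> \<bar>\<bar>f \<sigma> - f' \<sigma>\<bar> + \<bar>h \<sigma> - h' \<sigma>\<bar>\<bar>" for \<sigma>
        using C[of "f \<sigma>" "h \<sigma>" "f' \<sigma>" "h' \<sigma>"] by simp
    qed (use m in auto)
    also have "\<dots> \<le> nrm (\<lambda>\<sigma>. \<bar>f \<sigma> - f' \<sigma>\<bar>) + nrm (\<lambda>\<sigma>. \<bar>h \<sigma> - h' \<sigma>\<bar>)"
      by (rule l2norm_triangle[OF d])
    also have "\<dots> = nrm (\<lambda>\<sigma>. f \<sigma> - f' \<sigma>) + nrm (\<lambda>\<sigma>. h \<sigma> - h' \<sigma>)" by (simp add: l2norm_def)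
    finally show ?thesis using f'(2) h'(2) by linarith
  qed
  ultimately show "\<exists>g. local g \<and> nrm (\<lambda>\<sigma>. C (f \<sigma>) (h \<sigma>) - g \<sigma>) < e" by blast
qed

lemma approximable_cmult:
  assumes "approximable f" shows "approximable (\<lambda>\<sigma>. a * f \<sigma>)"
  unfolding approximable_def
proof (intro allI impI)
  fix e :: real assume e: "e > 0"
  \<comment> \<open>Adding 1 to the absolute value of \<open>a\<close> covers \<open>a = 0\<close>
    and leaves a strict inequality at the end.\<close>
  then have "e / (\<bar>a\<bar> + 1) > 0" by (intro divide_pos_pos) auto
  then obtain g where g: "local g" "nrm (\<lambda>\<sigma>. f \<sigma> - g \<sigma>) < e / (\<bar>a\<bar> + 1)"
    using assms unfolding approximable_def by blast
  have "nrm (\<lambda>\<sigma>. a * f \<sigma> - a * g \<sigma>) = \<bar>a\<bar> * nrm (\<lambda>\<sigma>. f \<sigma> - g \<sigma>)"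
    unfolding right_diff_distrib[symmetric] by (rule l2norm_cmult)
  also have "\<dots> \<le> \<bar>a\<bar> * (e / (\<bar>a\<bar> + 1))" using g(2) by (intro mult_left_mono) auto
  also have "\<dots> < e" using e by (simp add: field_simps)
  finally show "\<exists>g. local g \<and> nrm (\<lambda>\<sigma>. a * f \<sigma> - g \<sigma>) < e"
    using local_cmult[OF g(1)] by blast
qed

lemma approximable_limit:
  assumes u: "L2 u" and U: "\<And>n. approximable (U n)" "\<And>n. L2 (U n)"
    and lim: "(\<lambda>n. nrm (\<lambda>\<sigma>. u \<sigma> - U n \<sigma>)) \<longlonglongrightarrow> 0"
  shows "approximable u"
  unfolding approximable_def
proof (intro allI impI)
  fix e :: real assume "e > 0"
  then have e2: "e / 2 > 0" by simp
  have "\<forall>\<^sub>F n in sequentially. nrm (\<lambda>\<sigma>. u \<sigma> - U n \<sigma>) < e / 2"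
    using lim e2 by (rule order_tendstoD)
  then obtain n where n: "nrm (\<lambda>\<sigma>. u \<sigma> - U n \<sigma>) < e / 2" by (auto simp: eventually_sequentially)
  obtain g where g: "local g" "nrm (\<lambda>\<sigma>. U n \<sigma> - g \<sigma>) < e / 2"
    using U(1)[of n] e2 unfolding approximable_def by blast
  have "nrm (\<lambda>\<sigma>. u \<sigma> - g \<sigma>) = nrm (\<lambda>\<sigma>. (u \<sigma> - U n \<sigma>) + (U n \<sigma> - g \<sigma>))" by simp
  also have "\<dots> \<le> nrm (\<lambda>\<sigma>. u \<sigma> - U n \<sigma>) + nrm (\<lambda>\<sigma>. U n \<sigma> - g \<sigma>)"
    using u U(2)[of n] local_L2[OF g(1)] by (intro l2norm_triangle sq_integrable_diff)
  finally show "\<exists>g. local g \<and> nrm (\<lambda>\<sigma>. u \<sigma> - g \<sigma>) < e" using g n by (intro exI[of _ g]) auto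
qed

lemma L2_indicator: "A \<in> sets P \<Longrightarrow> L2 (indicator A)"
  by (rule sq_integrable_bounded[where K = 1]) (auto simp: indicator_def)

text \<open>Coordinate events are local; complements are differences from 1, finite unions are
  maxima, and countable unions are increasing limits. This matches the induction over the generated
  sigma-algebra.\<close>

lemma approximable_indicator:
  assumes "A \<in> sets P" shows "approximable (indicator A)"
proof -
  let ?G = "{{\<sigma> \<in> \<Pi>\<^sub>E i\<in>UNIV. space (count_space {-1, 1}). \<sigma> i \<in> B} | i B.
    i \<in> (UNIV :: 'a set) \<and> B \<in> sets (count_space {-1, 1 :: int})}"
  have sp: "space P = (\<Pi>\<^sub>E i\<in>UNIV. space (count_space {-1, 1}))"
    by (auto simp: space_P PiE_def Pi_def)
  have sg: "sets P = sigma_sets (space P) ?G"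
    unfolding sets_P sets_PiM_single sp ..
  have "A \<in> sigma_sets (space P) ?G" using assms sg by simp
  then show ?thesis
  proof (induction rule: sigma_sets.induct)
    case (Basic a)
    then obtain i B where a: "a = {\<sigma> \<in> space P. \<sigma> i \<in> B}" unfolding sp by blast
    show ?case
      by (rule approximable_cong[OF local_approximable[OF local_coordinate[of B i]]])
        (auto simp: a indicator_def)
  next
    case Empty
    show ?case by (rule approximable_cong[OF local_approximable[OF local_const[of 0]]]) auto
  next
    case (Compl a)
    have "a \<in> sets P" using Compl.hyps sg by simp
    then have "L2 (indicator a)" by (rule L2_indicator)
    then have "approximable (\<lambda>\<sigma>. (1 :: real) - indicator a \<sigma>)"
      using Compl.IH local_L2[OF local_const[of 1]] local_approximable[OF local_const[of 1]]
      by (intro approximable_combine[where C = "(-)" and f = "\<lambda>_. 1" and h = "indicator a"]) auto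
    then show ?case by (rule approximable_cong) (auto simp: indicator_def)
  next
    case (Union a)
    have a: "a n \<in> sets P" for n using Union.hyps sg by simp
    \<comment> \<open>Partial unions, empty at index 0: each step takes one maximum, and the
      indicators increase to that of the full union.\<close>
    define b where "b n = (\<Union>i<n. a i)" for n :: nat
    have b: "b n \<in> sets P" for n unfolding b_def using a by auto
    have app: "approximable (indicator (b n))" for n
    proof (induction n)
      case 0
      show ?case
        by (rule approximable_cong[OF local_approximable[OF local_const[of 0]]]) (auto simp: b_def)
    next
      case (Suc n)
      have mx: "approximable (\<lambda>\<sigma>. max (indicator (b n) \<sigma>) (indicator (a n) \<sigma>))"
        using Suc.IH Union.IH[of n] L2_indicator[OF a[of n]] L2_indicator[OF b[of n]]
        by (intro approximable_combine[where C = max and f = "indicator (b n)" and h = "indicator (a n)"]) auto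
      have "b (Suc n) = b n \<union> a n" by (auto simp: b_def less_Suc_eq)
      then show ?case
        by (intro approximable_cong[OF mx]) (auto simp: indicator_def)
    qed
    have Ub: "(\<Union>i. a i) \<in> sets P" using a by auto
    show ?case
    proof (rule approximable_limit[OF L2_indicator[OF Ub] app L2_indicator[OF b]])
      show "(\<lambda>n. nrm (\<lambda>\<sigma>. indicator (\<Union>i. a i) \<sigma> - indicator (b n) \<sigma>)) \<longlonglongrightarrow> 0"
      proof (rule l2norm_limit[OF L2_indicator[OF Ub]])
        show "indicator (b n) \<in> borel_measurable P" for n using b by simp
        fix \<sigma>
        have "incseq b" unfolding b_def by (force simp: incseq_def)
        moreover have "(\<Union>n. b n) = (\<Union>i. a i)" unfolding b_def by blast
        ultimately show "(\<lambda>n. indicator (b n) \<sigma> :: real) \<longlonglongrightarrow> indicator (\<Union>i. a i) \<sigma>"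
          using LIMSEQ_indicator_incseq[of b \<sigma>] by simp
      qed (auto simp: b_def indicator_def)
    qed
  qed
qed

text \<open>Square integrability is kept as a premise inside the induction: the pieces of a sum and
  the members of an increasing sequence inherit it because they are nonnegative and dominated by the
  whole.\<close>

lemma approximable_nonneg:
  assumes "u \<in> borel_measurable P" "\<And>\<sigma>. 0 \<le> u \<sigma>"
  shows "L2 u \<longrightarrow> approximable u"
  using assms
proof (induction u rule: borel_measurable_induct_real)
  case (set A)
  then show ?case using approximable_indicator by simp
next
  case (mult u c)
  show ?case
  proof (cases "c = 0")
    case True
    then show ?thesis using local_approximable[OF local_const[of 0]] by simp
  next
    case False
    show ?thesis
    proof
      assume "L2 (\<lambda>\<sigma>. c * u \<sigma>)"
      from sq_integrable_cmult[OF this, of "1 / c"] have "L2 u" using False by simp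
      then show "approximable (\<lambda>\<sigma>. c * u \<sigma>)" using mult by (intro approximable_cmult) simp
    qed
  qed
next
  case (add u v)
  show ?case
  proof
    assume L: "L2 (\<lambda>\<sigma>. v \<sigma> + u \<sigma>)"
    have uv: "L2 u" "L2 v"
      using add by (auto intro!: sq_integrable_bound[OF L])
    show "approximable (\<lambda>\<sigma>. v \<sigma> + u \<sigma>)"
      using add uv by (intro approximable_combine[where C = "(+)" and f = v and h = u]) auto
  qed
next
  case (seq U)
  show ?case
  proof
    assume L: "L2 u"
    have le: "U n \<sigma> \<le> u \<sigma>" if "\<sigma> \<in> space P" for n \<sigma>
    proof (rule incseq_le)
      show "incseq (\<lambda>n. U n \<sigma>)" using seq(3) by (auto simp: incseq_def le_fun_def)
      show "(\<lambda>n. U n \<sigma>) \<longlonglongrightarrow> u \<sigma>" using seq(4) that by blast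
    qed
    have LU: "L2 (U n)" for n
      by (rule sq_integrable_bound[OF L seq(1)])
        (use le[of _ n] seq(2)[of n] in \<open>auto intro: order_trans[OF _ abs_ge_self]\<close>)
    show "approximable u"
    proof (rule approximable_limit[OF L _ LU])
      show "approximable (U n)" for n using seq(5) LU by blast
      show "(\<lambda>n. nrm (\<lambda>\<sigma>. u \<sigma> - U n \<sigma>)) \<longlonglongrightarrow> 0"
        using L seq le by (intro l2norm_limit) auto
    qed
  qed
qed

lemma L2_approximable:
  assumes "L2 f" shows "approximable f"
proof -
  have [measurable]: "f \<in> borel_measurable P" using assms by (rule sq_integrableD)
  have L: "L2 (\<lambda>\<sigma>. max 0 (f \<sigma>))" "L2 (\<lambda>\<sigma>. max 0 (- f \<sigma>))"
    by (rule sq_integrable_bound[OF assms]; auto)+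
  have "approximable (\<lambda>\<sigma>. max 0 (f \<sigma>) - max 0 (- f \<sigma>))"
    using L approximable_nonneg[of "\<lambda>\<sigma>. max 0 (f \<sigma>)"] approximable_nonneg[of "\<lambda>\<sigma>. max 0 (- f \<sigma>)"]
    by (intro approximable_combine[where C = "(-)" and f = "\<lambda>\<sigma>. max 0 (f \<sigma>)" and h = "\<lambda>\<sigma>. max 0 (- f \<sigma>)"])
      auto
  then show ?thesis by (rule approximable_cong) auto
qed

section \<open>The variance bound\<close>

text \<open>The updates flatten a local \<open>g\<close> close to \<open>f\<close>. They are linear
  and contract the \<open>L2\<close> norm, so the updated \<open>f\<close> stays as close to the
  updated \<open>g\<close> as \<open>f\<close> was to \<open>g\<close>.\<close>

lemma nearly_constant:
  assumes "L2 f" "e > 0"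
  shows "\<exists>xs k. nrm (\<lambda>\<sigma>. fold E xs f \<sigma> - k) \<le> e"
proof -
  have e2: "e / 2 > 0" using assms by simp
  obtain g where g: "local g" "nrm (\<lambda>\<sigma>. f \<sigma> - g \<sigma>) < e / 2"
    using L2_approximable[OF assms(1)] e2 unfolding approximable_def by blast
  obtain S v where v: "local_lipschitz S v g" using g(1) by (auto simp: local_def)
  obtain \<sigma>0 where s0: "\<sigma>0 \<in> space P" using not_empty by blast
  obtain xs where xs: "\<And>\<sigma> \<tau>. \<sigma> \<in> space P \<Longrightarrow> \<tau> \<in> space P \<Longrightarrow> \<bar>fold E xs g \<sigma> - fold E xs g \<tau>\<bar> \<le> e / 2"
    using local_nearly_constant[OF v e2] by blast
  define k where "k = fold E xs g \<sigma>0"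
  have Lg: "L2 g" using local_L2[OF g(1)] .
  have Lk: "L2 (\<lambda>_. k)" by (rule local_L2[OF local_const])
  have Lfg: "L2 (fold E xs f)" "L2 (fold E xs g)" using assms(1) Lg by (auto intro: L2_fold_E)
  have "nrm (\<lambda>\<sigma>. fold E xs f \<sigma> - k) =
      nrm (\<lambda>\<sigma>. (fold E xs f \<sigma> - fold E xs g \<sigma>) + (fold E xs g \<sigma> - k))" by simp
  also have "\<dots> \<le> nrm (\<lambda>\<sigma>. fold E xs f \<sigma> - fold E xs g \<sigma>) + nrm (\<lambda>\<sigma>. fold E xs g \<sigma> - k)"
    using Lfg Lk by (intro l2norm_triangle sq_integrable_diff)
  also have "nrm (\<lambda>\<sigma>. fold E xs f \<sigma> - fold E xs g \<sigma>) \<le> nrm (\<lambda>\<sigma>. f \<sigma> - g \<sigma>)"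
    unfolding fold_E_diff[symmetric] using assms(1) Lg by (intro L2_fold_E sq_integrable_diff)
  also have "nrm (\<lambda>\<sigma>. fold E xs g \<sigma> - k) \<le> e / 2"
    using sq_integrable_diff[OF Lfg(2) Lk, THEN sq_integrableD] xs[OF _ s0] e2
    by (intro l2norm_bounded) (auto simp: k_def)
  finally show ?thesis using g(2) by (intro exI[of _ xs] exI[of _ k]) linarith
qed

text \<open>\<open>S\<close> consists of the updated sites and may depend on \<open>e\<close>. The
  sum over \<open>S\<close> bounds the covariance lost along the updates; what is left is small
  since the updated function is nearly constant and \<open>f0\<close> is centred.\<close>

lemma variance_bound:
  assumes "L2 f" "e > 0"
  shows "\<exists>S. finite S \<and> (\<integral>\<sigma>. (f \<sigma> - (\<integral>\<tau>. f \<tau> \<partial>P))\<^sup>2 \<partial>P)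
    \<le> (\<Sum>x\<in>S. (nrm (D x f))\<^sup>2) / (1 - 2 * b * real m) + e"
proof -
  define f0 where "f0 \<sigma> = f \<sigma> - (\<integral>\<tau>. f \<tau> \<partial>P)" for \<sigma>
  have L: "L2 f0"
    unfolding f0_def[abs_def] by (rule sq_integrable_diff[OF assms(1) local_L2[OF local_const]])
  have "integrable P f" using integrable_mult_sq[OF assms(1) local_L2[OF local_const[of 1]]] by simp
  then have mean: "(\<integral>\<sigma>. f0 \<sigma> \<partial>P) = 0" unfolding f0_def by (simp add: prob_space)
  have D0: "D x f0 = D x f" for x by (auto simp: D_def f0_def)
  \<comment> \<open>Chosen so that \<open>e' * nrm f0 \<le> e\<close>; the 1 keeps the denominator
    positive.\<close>
  define e' where "e' = e / (nrm f0 + 1)"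
  have n1: "nrm f0 + 1 > 0" using l2norm_nonneg[of P f0] by linarith
  then have "e' > 0" using assms(2) by (simp add: e'_def)
  from nearly_constant[OF L this] obtain xs k where k: "nrm (\<lambda>\<sigma>. fold E xs f0 \<sigma> - k) \<le> e'" by blast
  from covariance_along_updates[OF L L, of xs] obtain U where U:
    "\<And>y. 0 \<le> U y" "\<And>y. y \<notin> set xs \<Longrightarrow> U y = 0"
    "\<And>y. U y \<le> nrm (D y f0) + 2 * b * (\<Sum>z\<in>N y. U z)"
    "(\<integral>\<sigma>. f0 \<sigma> * f0 \<sigma> \<partial>P) - (\<integral>\<sigma>. fold E xs f0 \<sigma> * f0 \<sigma> \<partial>P) \<le> (\<Sum>y\<in>set xs. U y * nrm (D y f0))"
    by blast
  have LE: "L2 (fold E xs f0)" using L by (rule L2_fold_E)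
  have LEk: "L2 (\<lambda>\<sigma>. fold E xs f0 \<sigma> - k)" using LE local_L2[OF local_const] by (rule sq_integrable_diff)
  have if0: "integrable P f0" using integrable_mult_sq[OF L local_L2[OF local_const[of 1]]] by simp
  \<comment> \<open>As \<open>f0\<close> has mean 0, the constant \<open>k\<close> can be subtracted
    from the other factor.\<close>
  have "(\<integral>\<sigma>. fold E xs f0 \<sigma> * f0 \<sigma> \<partial>P) = (\<integral>\<sigma>. (fold E xs f0 \<sigma> - k) * f0 \<sigma> + k * f0 \<sigma> \<partial>P)"
    by (simp add: algebra_simps)
  also have "\<dots> = (\<integral>\<sigma>. (fold E xs f0 \<sigma> - k) * f0 \<sigma> \<partial>P)"
    using integrable_mult_sq[OF LEk L] if0 mean by simp
  also have "\<dots> \<le> nrm (\<lambda>\<sigma>. fold E xs f0 \<sigma> - k) * nrm f0"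
    using l2norm_Cauchy_Schwarz[OF LEk L] by linarith
  also have "\<dots> \<le> e' * nrm f0" using k by (intro mult_right_mono) auto
  also have "\<dots> \<le> e" using n1 assms(2) by (simp add: e'_def field_simps)
  finally have small: "(\<integral>\<sigma>. fold E xs f0 \<sigma> * f0 \<sigma> \<partial>P) \<le> e" .
  have "(\<Sum>y\<in>set xs. U y * nrm (D y f0)) \<le> (\<Sum>y\<in>set xs. (nrm (D y f0))\<^sup>2) / (1 - 2 * b * real m)"
    using U(1-3) by (intro removed_oscillation_bound) auto
  then have "(\<integral>\<sigma>. (f0 \<sigma>)\<^sup>2 \<partial>P) \<le> (\<Sum>x\<in>set xs. (nrm (D x f))\<^sup>2) / (1 - 2 * b * real m) + e"
    using U(4) small by (simp add: D0 power2_eq_square)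
  then show ?thesis unfolding f0_def by (intro exI[of _ "set xs"]) simp
qed

end

section \<open>The Ising specification\<close>

lemma nbr_upd:
  fixes x y :: "'d::finite site"
  assumes "nbr x y"
  shows "\<exists>i. \<exists>s\<in>{1, -1}. y = x(i := x i + s)"
proof -
  have sum: "(\<Sum>i\<in>UNIV. \<bar>x i - y i\<bar>) = 1" using assms by (simp add: nbr_def)
  then have "\<exists>i. x i \<noteq> y i" by (rule_tac ccontr) simp
  then obtain i where i: "x i \<noteq> y i" by blast
  \<comment> \<open>A single differing integer coordinate already uses up the distance 1, so all
    other coordinates agree.\<close>
  have "(\<Sum>j\<in>UNIV. \<bar>x j - y j\<bar>) = \<bar>x i - y i\<bar> + (\<Sum>j\<in>UNIV - {i}. \<bar>x j - y j\<bar>)"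
    by (rule sum.remove) auto
  moreover have ge: "0 \<le> (\<Sum>j\<in>UNIV - {i}. \<bar>x j - y j\<bar>)" by (rule sum_nonneg) simp
  moreover have "\<bar>x i - y i\<bar> \<ge> 1" using i by linarith
  ultimately have one: "\<bar>x i - y i\<bar> = 1" and "(\<Sum>j\<in>UNIV - {i}. \<bar>x j - y j\<bar>) = 0"
    using sum by linarith+
  then have "\<forall>j\<in>UNIV - {i}. \<bar>x j - y j\<bar> = 0" by (subst (asm) sum_nonneg_eq_0_iff) auto
  then have "y = x(i := x i + (y i - x i))" by (auto simp: fun_eq_iff)
  moreover have "y i - x i \<in> {1, -1}" using one by auto
  ultimately show ?thesis by blast
qed

lemma nbr_finite_card:
  fixes x :: "'d::finite site"
  shows "finite {y. nbr x y}" "card {y. nbr x y} \<le> 2 * CARD('d)"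
proof -
  let ?g = "\<lambda>(i, s). x(i := x i + s)"
  let ?A = "(UNIV :: 'd set) \<times> {1, -1 :: int}"
  have sub: "{y. nbr x y} \<subseteq> ?g ` ?A" using nbr_upd by fastforce
  then show "finite {y. nbr x y}" by (rule finite_subset) simp
  have "card {y. nbr x y} \<le> card (?g ` ?A)" using sub by (intro card_mono) auto
  also have "\<dots> \<le> card ?A" by (rule card_image_le) simp
  also have "\<dots> = 2 * CARD('d)" by (simp add: card_cartesian_product)
  finally show "card {y. nbr x y} \<le> 2 * CARD('d)" .
qed

lemma nbr_sym: "nbr x y \<longleftrightarrow> nbr y x"
  by (simp add: nbr_def abs_minus_commute)

lemma nbr_irrefl: "\<not> nbr x x"
  by (simp add: nbr_def)

section \<open>Conditional probabilities as functions of the local field\<close>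

lemma tanh_lipschitz: "\<bar>tanh u - tanh v\<bar> \<le> \<bar>u - v\<bar>" for u v :: real
proof -
  have "norm (tanh u - tanh v) \<le> 1 * norm (u - v)"
  proof (rule field_differentiable_bound[where S = UNIV and f' = "\<lambda>z. 1 - (tanh z)\<^sup>2"])
    fix z :: real
    show "(tanh has_field_derivative 1 - (tanh z)\<^sup>2) (at z within UNIV)"
      by (auto intro!: derivative_eq_intros)
    have "\<bar>tanh z\<bar> \<le> 1" using tanh_real_bounds[of z] by auto
    then have "(tanh z)\<^sup>2 \<le> 1" by (simp add: abs_square_le_1)
    then show "norm (1 - (tanh z)\<^sup>2) \<le> 1" by simp
  qed auto
  then show ?thesis by simp
qed

text \<open>The exponential is \<open>cosh + sinh\<close>. In this form the Lipschitz bound for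
  \<open>tanh\<close> controls both the distance from 1/2 and the influence of neighbours.\<close>

lemma cond_plus_tanh: "cond_plus \<beta> J 0 \<sigma> x = (1 + tanh (\<beta> * J * local_field \<sigma> x)) / 2"
proof -
  let ?u = "\<beta> * J * local_field \<sigma> x"
  have "cond_plus \<beta> J 0 \<sigma> x = (cosh ?u + sinh ?u) / (2 * cosh ?u)"
    by (simp add: cond_plus_def cosh_plus_sinh)
  also have "\<dots> = (1 + tanh ?u) / 2" by (simp add: tanh_def field_simps)
  finally show ?thesis .
qed

text \<open>A disagreeing neighbour changes its summand by 2, which later cancels the 1/2 in
  \<open>cond_plus_tanh\<close> and leaves the influence \<beta>.\<close>

lemma local_field_diff:
  assumes "\<And>y. \<sigma> y \<in> {-1, 1}" "\<And>y. \<tau> y \<in> {-1, 1}"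
  shows "\<bar>local_field \<sigma> x - local_field \<tau> x\<bar> \<le> 2 * real (card {y \<in> {y. nbr x y}. \<sigma> y \<noteq> \<tau> y})"
proof -
  have "\<bar>local_field \<sigma> x - local_field \<tau> x\<bar> = \<bar>\<Sum>y | nbr x y. real_of_int (\<sigma> y) - real_of_int (\<tau> y)\<bar>"
    by (simp add: local_field_def sum_subtractf)
  also have "\<dots> \<le> (\<Sum>y | nbr x y. \<bar>real_of_int (\<sigma> y) - real_of_int (\<tau> y)\<bar>)" by (rule sum_abs)
  also have "\<dots> \<le> (\<Sum>y | nbr x y. if \<sigma> y \<noteq> \<tau> y then 2 else 0)"
  proof (rule sum_mono)
    fix y show "\<bar>real_of_int (\<sigma> y) - real_of_int (\<tau> y)\<bar> \<le> (if \<sigma> y \<noteq> \<tau> y then 2 else 0)"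
      using assms(1)[of y] assms(2)[of y] by auto
  qed
  also have "\<dots> = 2 * real (card {y \<in> {y. nbr x y}. \<sigma> y \<noteq> \<tau> y})"
    using nbr_finite_card(1)[of x] by (simp add: sum.If_cases Int_def)
  finally show ?thesis .
qed

lemma local_field_bound:
  fixes \<sigma> :: "'d::finite config"
  assumes "\<And>y. \<sigma> y \<in> {-1, 1}"
  shows "\<bar>local_field \<sigma> x\<bar> \<le> 2 * real CARD('d)"
proof -
  have "\<bar>local_field \<sigma> x\<bar> \<le> (\<Sum>y | nbr x y. \<bar>real_of_int (\<sigma> y)\<bar>)"
    unfolding local_field_def by (rule sum_abs)
  also have "\<dots> = (\<Sum>y | nbr x y. 1)"
  proof (rule sum.cong)
    fix y show "\<bar>real_of_int (\<sigma> y)\<bar> = 1" using assms[of y] by auto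
  qed simp
  also have "\<dots> \<le> 2 * real CARD('d)" using nbr_finite_card(2)[of x] by simp
  finally show ?thesis .
qed

text \<open>The hypothesis \<open>cond\<close> says that the measures with densities
  \<open>indicator B\<close> and \<open>w\<close> have the same image under \<pi>; the conclusion
  integrates \<open>h\<close> against this common image.\<close>

lemma (in prob_space) nn_integral_conditional:
  assumes [measurable]: "B \<in> sets M" "w \<in> borel_measurable M" "\<pi> \<in> measurable M M" "h \<in> borel_measurable M"
    and w: "\<And>x. x \<in> space M \<Longrightarrow> 0 \<le> w x \<and> w x \<le> 1"
    and cond: "\<And>A. A \<in> sets M \<Longrightarrow>
      measure M (B \<inter> (\<pi> -` A \<inter> space M)) = (\<integral>x. indicator (\<pi> -` A \<inter> space M) x * w x \<partial>M)"
  shows "(\<integral>\<^sup>+x. indicator B x * h (\<pi> x) \<partial>M) = (\<integral>\<^sup>+x. ennreal (w x) * h (\<pi> x) \<partial>M)"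
proof -
  have "distr (density M (indicator B)) M \<pi> = distr (density M (\<lambda>x. ennreal (w x))) M \<pi>"
  proof (rule measure_eqI)
    fix A assume "A \<in> sets (distr (density M (indicator B)) M \<pi>)"
    then have A [measurable]: "A \<in> sets M" by simp
    define C where "C = \<pi> -` A \<inter> space M"
    have C [measurable]: "C \<in> sets M" unfolding C_def by (rule measurable_sets[OF assms(3) A])
    have "emeasure (distr (density M (indicator B)) M \<pi>) A = (\<integral>\<^sup>+x. indicator B x * indicator C x \<partial>M)"
      by (simp add: emeasure_distr emeasure_density C_def)
    also have "\<dots> = emeasure M (B \<inter> C)"
      by (simp flip: indicator_inter_arith)
    also have "\<dots> = ennreal (\<integral>x. indicator C x * w x \<partial>M)"
      using cond[OF A] by (simp add: emeasure_eq_measure C_def)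
    also have "\<dots> = (\<integral>\<^sup>+x. ennreal (indicator C x * w x) \<partial>M)"
    proof (rule nn_integral_eq_integral[symmetric])
      show "integrable M (\<lambda>x. indicator C x * w x)"
        by (rule integrable_const_bound[where B = 1]) (use w in \<open>auto simp: indicator_def abs_le_iff\<close>)
      show "AE x in M. 0 \<le> indicator C x * w x" using w by auto
    qed
    also have "\<dots> = (\<integral>\<^sup>+x. ennreal (w x) * indicator C x \<partial>M)"
      by (rule nn_integral_cong) (auto simp: indicator_def)
    also have "\<dots> = emeasure (distr (density M (\<lambda>x. ennreal (w x))) M \<pi>) A"
      by (simp add: emeasure_distr emeasure_density C_def)
    finally show "emeasure (distr (density M (indicator B)) M \<pi>) A =
      emeasure (distr (density M (\<lambda>x. ennreal (w x))) M \<pi>) A" .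
  qed simp
  then have "(\<integral>\<^sup>+x. h x \<partial>distr (density M (indicator B)) M \<pi>) =
    (\<integral>\<^sup>+x. h x \<partial>distr (density M (\<lambda>x. ennreal (w x))) M \<pi>)" by simp
  then show ?thesis by (simp add: nn_integral_distr nn_integral_density)
qed

text \<open>Pinning the spin at \<open>x\<close> makes that coordinate constant, so the map is
  measurable for the sigma-algebra of the other spins. Its preimages are thus admissible test events
  in \<open>ising_mrf\<close>.\<close>

lemma vimage_upd_outside_sigma:
  fixes x :: "'d::finite site"
  assumes "A \<in> sets (spin_space :: 'd config measure)" "s \<in> {-1, 1}"
  shows "(\<lambda>\<sigma>. \<sigma>(x := s)) -` A \<inter> space spin_space \<in> outside_sigma x"
proof -
  let ?G = "{(\<lambda>\<sigma>. \<sigma> y) -` {r} \<inter> space spin_space | y r. y \<noteq> x} :: 'd config set set"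
  let ?N = "sigma (space spin_space) ?G :: 'd config measure"
  have sub: "?G \<subseteq> Pow (space spin_space)" by auto
  then have sets_N: "sets ?N = outside_sigma x" by (simp add: outside_sigma_def)
  have space_N: "space ?N = space spin_space" using sub by (rule space_measure_of)
  have sp: "\<sigma> y \<in> {-1, 1}" if "\<sigma> \<in> space (spin_space :: 'd config measure)" for \<sigma> y
    using that by (auto simp: spin_space_def space_PiM PiE_def Pi_def)
  have "(\<lambda>\<sigma> i. if i = x then s else \<sigma> i) \<in> measurable ?N (PiM UNIV (\<lambda>_. count_space {-1, 1}))"
  proof (rule measurable_PiM_single')
    fix i show "(\<lambda>\<sigma>. if i = x then s else \<sigma> i) \<in> measurable ?N (count_space {-1, 1})"
    proof (cases "i = x")
      case False
      have "(\<lambda>\<sigma>. \<sigma> i) \<in> measurable ?N (count_space {-1, 1})"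
      proof (rule measurable_count_space_eq2_countable[THEN iffD2])
        show "(\<lambda>\<sigma>. \<sigma> i) \<in> space ?N \<rightarrow> {-1, 1} \<and> (\<forall>a\<in>{-1, 1}. (\<lambda>\<sigma>. \<sigma> i) -` {a} \<inter> space ?N \<in> sets ?N)"
        proof (intro conjI ballI)
          show "(\<lambda>\<sigma>. \<sigma> i) \<in> space ?N \<rightarrow> {-1, 1}" unfolding space_N using sp by blast
          fix a :: int
          have "(\<lambda>\<sigma>. \<sigma> i) -` {a} \<inter> space spin_space \<in> ?G" using False by blast
          then show "(\<lambda>\<sigma>. \<sigma> i) -` {a} \<inter> space ?N \<in> sets ?N"
            unfolding space_N sets_N outside_sigma_def by (rule sigma_sets.Basic)
        qed
      qed
      then show ?thesis using False by simp
    qed (use assms in simp)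
  next
    show "(\<lambda>\<sigma> i. if i = x then s else \<sigma> i) \<in> space ?N \<rightarrow> (\<Pi>\<^sub>E i\<in>UNIV. space (count_space {-1, 1}))"
      unfolding space_N using assms(2) sp by fastforce
  qed
  then have "(\<lambda>\<sigma>. \<sigma>(x := s)) \<in> measurable ?N spin_space"
    by (simp add: fun_upd_def spin_space_def)
  from measurable_sets[OF this assms(1)] show ?thesis unfolding space_N sets_N .
qed

text \<open>With \<open>b\<close> equal to \<beta> and \<open>m\<close> twice the dimension, the
  quantity \<open>2 * b * m\<close> is exactly the one bounded by \<open>small\<close>. The
  resampling identity integrates the conditional law against functions of the other spins.\<close>

lemma ising_weakly_dependent_field:
  fixes P :: "('d::finite) config measure"
  assumes "\<beta> > 0" "J \<in> {-1, 1}" "ising_mrf \<beta> J 0 P" and small: "4 * \<beta> * real CARD('d) < 5/8"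
  shows "weakly_dependent_field P (\<lambda>x \<sigma>. cond_plus \<beta> J 0 \<sigma> x) (\<lambda>x. {y. nbr x y}) \<beta> (2 * CARD('d))"
proof -
  have P: "prob_space P" and sets: "sets P = sets spin_space"
    and mrf: "\<And>x A. A \<in> outside_sigma x \<Longrightarrow> measure P ({\<sigma> \<in> space P. \<sigma> x = 1} \<inter> A) =
      (\<integral>\<sigma>. indicator A \<sigma> * cond_plus \<beta> J 0 \<sigma> x \<partial>P)"
    using assms(3) by (auto simp: ising_mrf_def)
  have spaces: "space P = space spin_space" using sets by (rule sets_eq_imp_space_eq)
  interpret spin_field P
    using P sets by (simp add: spin_field_def spin_field_axioms_def spin_space_def)
  let ?q = "\<lambda>x \<sigma>. cond_plus \<beta> J 0 \<sigma> x"
  have J: "\<bar>J\<bar> = 1" using assms(2) by auto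
  have sp: "\<sigma> y \<in> {-1, 1}" if "\<sigma> \<in> space P" for \<sigma> y using that by (auto simp: space_P)
  have coord [measurable]: "(\<lambda>\<sigma>. real_of_int (\<sigma> y)) \<in> borel_measurable P" for y
    by (rule measurable_compose[OF measurable_coord]) simp
  have [measurable]: "(\<lambda>\<sigma>. local_field \<sigma> x) \<in> borel_measurable P" for x
    unfolding local_field_def by measurable
  have [measurable]: "(tanh :: real \<Rightarrow> real) \<in> borel_measurable borel"
    by (intro borel_measurable_continuous_onI continuous_intros) auto
  have qm [measurable]: "?q x \<in> borel_measurable P" for x
    unfolding cond_plus_tanh by measurable
  have qb: "1/3 \<le> ?q x \<sigma> \<and> ?q x \<sigma> \<le> 2/3" if s: "\<sigma> \<in> space P" for x \<sigma>
  proof -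
    have "\<bar>tanh (\<beta> * J * local_field \<sigma> x)\<bar> \<le> \<bar>\<beta> * J * local_field \<sigma> x\<bar>"
      using tanh_lipschitz[of "\<beta> * J * local_field \<sigma> x" 0] by simp
    also have "\<dots> = \<beta> * \<bar>local_field \<sigma> x\<bar>" using assms(1) J by (simp add: abs_mult)
    also have "\<dots> \<le> \<beta> * (2 * real CARD('d))"
      using assms(1) local_field_bound[OF sp[OF s]] by (intro mult_left_mono) auto
    finally show ?thesis using small unfolding cond_plus_tanh by simp linarith
  qed
  have resample: "(\<integral>\<^sup>+\<sigma>. F \<sigma> \<partial>P) =
      (\<integral>\<^sup>+\<sigma>. ennreal (?q x \<sigma>) * F (\<sigma>(x := 1)) + ennreal (1 - ?q x \<sigma>) * F (\<sigma>(x := -1)) \<partial>P)"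
    if F: "F \<in> borel_measurable P" for F x
  proof -
    define B where "B = {\<sigma> \<in> space P. \<sigma> x = 1}"
    let ?pi = "\<lambda>\<sigma>. \<sigma>(x := 1) :: 'd config"
    have pi [measurable]: "?pi \<in> measurable P P" by (rule measurable_upd) simp
    have "B = (\<lambda>\<sigma>. real_of_int (\<sigma> x)) -` {1} \<inter> space P" by (auto simp: B_def)
    then have B [measurable]: "B \<in> sets P" using measurable_sets[OF coord] by simp
    note [measurable] = F measurable_upd_comp(1)[OF F, of x]
    have F' [measurable]: "(\<lambda>\<sigma>. F (\<sigma>(x := -1))) \<in> borel_measurable P" by (rule measurable_upd_comp(2)[OF F])
    have q01: "0 \<le> ?q x \<sigma> \<and> ?q x \<sigma> \<le> 1" if "\<sigma> \<in> space P" for \<sigma> using qb[OF that, of x] by auto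
    have plus: "measure P (B \<inter> (?pi -` A \<inter> space P)) = (\<integral>\<sigma>. indicator (?pi -` A \<inter> space P) \<sigma> * ?q x \<sigma> \<partial>P)"
      if "A \<in> sets P" for A
      unfolding B_def using that vimage_upd_outside_sigma[of A 1 x] by (intro mrf) (simp add: sets spaces)
    have minus: "measure P ((space P - B) \<inter> (?pi -` A \<inter> space P)) =
        (\<integral>\<sigma>. indicator (?pi -` A \<inter> space P) \<sigma> * (1 - ?q x \<sigma>) \<partial>P)" if A: "A \<in> sets P" for A
    proof -
      define C where "C = ?pi -` A \<inter> space P"
      have C [measurable]: "C \<in> sets P" unfolding C_def by (rule measurable_sets[OF pi A])
      have i: "integrable P (\<lambda>\<sigma>. indicator C \<sigma> * ?q x \<sigma>)"
        by (rule integrable_const_bound[where B = 1]) (use q01 in \<open>auto simp: indicator_def abs_le_iff\<close>)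
      have "measure P ((space P - B) \<inter> C) = measure P (C - B)"
        using sets.sets_into_space[OF C] by (intro arg_cong[where f = "measure P"]) auto
      also have "\<dots> = measure P C - measure P (B \<inter> C)"
        by (simp add: finite_measure_Diff' Int_commute)
      also have "\<dots> = (\<integral>\<sigma>. indicator C \<sigma> \<partial>P) - (\<integral>\<sigma>. indicator C \<sigma> * ?q x \<sigma> \<partial>P)"
        using plus[OF A] by (simp add: C_def[symmetric])
      also have "\<dots> = (\<integral>\<sigma>. indicator C \<sigma> - indicator C \<sigma> * ?q x \<sigma> \<partial>P)"
        using i by (intro Bochner_Integration.integral_diff[symmetric]) (auto simp: less_top[symmetric])
      also have "\<dots> = (\<integral>\<sigma>. indicator C \<sigma> * (1 - ?q x \<sigma>) \<partial>P)" by (simp add: right_diff_distrib)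
      finally show ?thesis unfolding C_def .
    qed
    \<comment> \<open>On spin -1 the value is written through \<open>?pi\<close> followed by
      resetting the spin, so both integrands are an indicator times a function of
      \<open>?pi \<sigma>\<close>, and \<open>nn_integral_conditional\<close> applies to
      each.\<close>
    have "(\<integral>\<^sup>+\<sigma>. F \<sigma> \<partial>P) =
      (\<integral>\<^sup>+\<sigma>. indicator B \<sigma> * F (?pi \<sigma>) + indicator (space P - B) \<sigma> * F ((?pi \<sigma>)(x := -1)) \<partial>P)"
    proof (rule nn_integral_cong)
      fix \<sigma> assume s: "\<sigma> \<in> space P"
      have "\<sigma> x = 1 \<or> \<sigma> x = -1" using sp[OF s, of x] by auto
      then show "F \<sigma> = indicator B \<sigma> * F (?pi \<sigma>) + indicator (space P - B) \<sigma> * F ((?pi \<sigma>)(x := -1))"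
      proof
        assume e: "\<sigma> x = 1"
        then have "?pi \<sigma> = \<sigma>" by auto
        then show ?thesis using e s by (simp add: B_def)
      next
        assume e: "\<sigma> x = -1"
        then have "(?pi \<sigma>)(x := -1) = \<sigma>" by auto
        then show ?thesis using e s by (simp add: B_def)
      qed
    qed
    also have "\<dots> = (\<integral>\<^sup>+\<sigma>. indicator B \<sigma> * F (?pi \<sigma>) \<partial>P) +
        (\<integral>\<^sup>+\<sigma>. indicator (space P - B) \<sigma> * F ((?pi \<sigma>)(x := -1)) \<partial>P)"
      by (rule nn_integral_add) auto
    also have "(\<integral>\<^sup>+\<sigma>. indicator B \<sigma> * F (?pi \<sigma>) \<partial>P) = (\<integral>\<^sup>+\<sigma>. ennreal (?q x \<sigma>) * F (?pi \<sigma>) \<partial>P)"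
      using B qm pi F q01 plus by (rule nn_integral_conditional)
    also have "(\<integral>\<^sup>+\<sigma>. indicator (space P - B) \<sigma> * F ((?pi \<sigma>)(x := -1)) \<partial>P) =
        (\<integral>\<^sup>+\<sigma>. ennreal (1 - ?q x \<sigma>) * F ((?pi \<sigma>)(x := -1)) \<partial>P)"
    proof (rule nn_integral_conditional[OF _ _ pi F'])
      show "0 \<le> 1 - ?q x \<sigma> \<and> 1 - ?q x \<sigma> \<le> 1" if "\<sigma> \<in> space P" for \<sigma> using q01[OF that] by simp
    qed (use minus in auto)
    also have "(\<integral>\<^sup>+\<sigma>. ennreal (?q x \<sigma>) * F (?pi \<sigma>) \<partial>P) +
        (\<integral>\<^sup>+\<sigma>. ennreal (1 - ?q x \<sigma>) * F ((?pi \<sigma>)(x := -1)) \<partial>P) =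
      (\<integral>\<^sup>+\<sigma>. ennreal (?q x \<sigma>) * F (?pi \<sigma>) + ennreal (1 - ?q x \<sigma>) * F ((?pi \<sigma>)(x := -1)) \<partial>P)"
      by (rule nn_integral_add[symmetric]) auto
    finally show ?thesis by simp
  qed
  have infl: "\<bar>?q x \<sigma> - ?q x \<tau>\<bar> \<le> \<beta> * real (card {y \<in> {y. nbr x y}. \<sigma> y \<noteq> \<tau> y})"
    if "\<sigma> \<in> space P" "\<tau> \<in> space P" for x \<sigma> \<tau>
  proof -
    have "\<bar>?q x \<sigma> - ?q x \<tau>\<bar> = \<bar>tanh (\<beta> * J * local_field \<sigma> x) - tanh (\<beta> * J * local_field \<tau> x)\<bar> / 2"
      unfolding cond_plus_tanh by (simp add: diff_divide_distrib[symmetric])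
    also have "\<dots> \<le> \<bar>\<beta> * J * local_field \<sigma> x - \<beta> * J * local_field \<tau> x\<bar> / 2"
      using tanh_lipschitz by (intro divide_right_mono) auto
    also have "\<dots> = \<beta> * \<bar>local_field \<sigma> x - local_field \<tau> x\<bar> / 2"
      using assms(1) J by (simp add: right_diff_distrib[symmetric] abs_mult)
    also have "\<dots> \<le> \<beta> * (2 * real (card {y \<in> {y. nbr x y}. \<sigma> y \<noteq> \<tau> y})) / 2"
      using assms(1) local_field_diff[OF sp[OF that(1)] sp[OF that(2)]]
      by (intro divide_right_mono mult_left_mono) auto
    finally show ?thesis by simp
  qed
  show ?thesis
  proof unfold_locales
    show "2 * \<beta> * real (2 * CARD('d)) < 1" using small by simp
    show "card {y. nbr x y} \<le> 2 * CARD('d)" "finite {y. nbr x y}" for x :: "'d site"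
      by (rule nbr_finite_card)+
    show "y \<in> {y. nbr x y} \<longleftrightarrow> x \<in> {z. nbr y z}" for x y :: "'d site" using nbr_sym by auto
    show "x \<notin> {y. nbr x y}" for x :: "'d site" using nbr_irrefl by auto
  qed (use qm qb infl resample assms(1) in \<open>auto simp del: fun_upd_apply\<close>)
qed

text \<open>The threshold 5/8 is small enough that conditional probabilities differ from 1/2 by at most
  5/32 < 1/6, hence lie in the interval [1/3, 2/3].\<close>

lemma small_inverse_temperature:
  fixes s :: real
  assumes "s \<ge> 0" "exp s - exp (- s) < 1"
  shows "s < 5/8"
proof (rule ccontr)
  assume "\<not> s < 5/8"
  then have s: "s \<ge> 5/8" by simp
  \<comment> \<open>At \<open>s \<ge> 5/8\<close> the difference of exponentials is at least
    \<open>13/8 - 8/13 = 105/104\<close>, just above 1.\<close>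
  have "exp s \<ge> 1 + s" by (rule exp_ge_add_one_self)
  moreover have "exp (- s) \<le> 1 / (1 + s)"
    using \<open>exp s \<ge> 1 + s\<close> assms(1) by (simp add: exp_minus field_simps)
  moreover have "1 / (1 + s) \<le> 8/13" using s by (simp add: field_simps)
  ultimately show False using s assms(2) by linarith
qed

section \<open>Passage to the Dirichlet form and the Poincare inequality\<close>

lemma sum_le_dirichlet:
  fixes P :: "('d::finite) config measure"
  assumes "finite S"
  shows "(\<Sum>x\<in>S. \<integral>\<^sup>+\<sigma>. ennreal ((f (flip x \<sigma>) - f \<sigma>)\<^sup>2) \<partial>P) \<le> dirichlet P f"
proof -
  let ?g = "\<lambda>x. \<integral>\<^sup>+\<sigma>. ennreal ((f (flip x \<sigma>) - f \<sigma>)\<^sup>2) \<partial>P"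
  have "(\<Sum>x\<in>S. ?g x) = (\<Sum>x\<in>S. ?g x * indicator S x)" by (rule sum.cong) auto
  also have "\<dots> = (\<integral>\<^sup>+x. ?g x * indicator S x \<partial>count_space UNIV)"
    using assms by (intro nn_integral_count_space'[symmetric]) auto
  also have "\<dots> \<le> dirichlet P f"
    unfolding dirichlet_def by (rule nn_integral_mono) (auto simp: indicator_def)
  finally show ?thesis .
qed

theorem theorem1:
  fixes \<beta> J h p c :: real
    and P :: "('d::finite) config measure"
  assumes "CARD('d) \<ge> 2"
    and "\<beta> > 0"
    and "J \<in> {-1, 1}"
    and "h = 0"
    and "ising_mrf \<beta> J h P"
    and "c = 2 * \<beta> * h + 4 * \<beta> * real CARD('d)"
    and "p = exp (-2 * \<beta> * h) * (exp (4 * \<beta> * real CARD('d)) - exp (-4 * \<beta> * real CARD('d)))"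
    and "p < 1"
    and "(\<integral>\<^sup>+ \<omega>. cluster_weight c (\<omega> :: 'd site \<Rightarrow> bool) \<partial>perc p) < \<infinity>"
  shows "\<exists>CP > 0. \<forall>f. f \<in> borel_measurable P \<and> integrable P (\<lambda>\<sigma>. (f \<sigma>)\<^sup>2) \<longrightarrow>
           ennreal (\<integral>\<sigma>. (f \<sigma> - (\<integral>\<tau>. f \<tau> \<partial>P))\<^sup>2 \<partial>P) \<le> ennreal CP * dirichlet P f"
proof -
  define s where "s = 4 * \<beta> * real CARD('d)"
  \<comment> \<open>With \<open>h = 0\<close> the prefactor of \<open>p\<close> is 1.\<close>
  have "exp s - exp (- s) < 1" using assms(4,7,8) by (simp add: s_def)
  then have s: "s < 5/8" using assms(2) by (intro small_inverse_temperature) (auto simp: s_def)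
  interpret weakly_dependent_field P "\<lambda>x \<sigma>. cond_plus \<beta> J 0 \<sigma> x" "\<lambda>x. {y. nbr x y}" \<beta> "2 * CARD('d)"
    using assms s by (intro ising_weakly_dependent_field) (auto simp: s_def)
  \<comment> \<open>The constant of \<open>variance_bound\<close>, since \<open>2 * b * m\<close>
    equals \<open>s\<close> here.\<close>
  define CP where "CP = 1 / (1 - s)"
  have CP: "CP > 0" using s by (simp add: CP_def)
  \<comment> \<open>Spins take only the values 1 and -1, so the flip gradient is plus or minus
    \<open>D x f\<close>, and squaring removes the sign.\<close>
  have flip: "(\<integral>\<^sup>+\<sigma>. ennreal ((f (flip x \<sigma>) - f \<sigma>)\<^sup>2) \<partial>P) = ennreal ((nrm (D x f))\<^sup>2)" if f: "L2 f" for f x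
  proof -
    have "(\<integral>\<^sup>+\<sigma>. ennreal ((f (flip x \<sigma>) - f \<sigma>)\<^sup>2) \<partial>P) = (\<integral>\<^sup>+\<sigma>. ennreal ((D x f \<sigma>)\<^sup>2) \<partial>P)"
    proof (rule nn_integral_cong)
      fix \<sigma> assume "\<sigma> \<in> space P"
      then have "\<sigma> x = 1 \<or> \<sigma> x = -1" by (auto simp: space_P)
      then show "ennreal ((f (flip x \<sigma>) - f \<sigma>)\<^sup>2) = ennreal ((D x f \<sigma>)\<^sup>2)"
      proof
        assume e: "\<sigma> x = 1"
        then have "\<sigma>(x := 1) = \<sigma>" by auto
        then show ?thesis using e by (simp add: D_def flip_def power2_commute)
      next
        assume e: "\<sigma> x = -1"
        then have "\<sigma>(x := -1) = \<sigma>" by auto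
        then show ?thesis using e by (simp add: D_def flip_def)
      qed
    qed
    also have "\<dots> = ennreal (\<integral>\<sigma>. (D x f \<sigma>)\<^sup>2 \<partial>P)"
      using L2_D[OF f, of x] by (intro nn_integral_eq_integral) (auto simp: sq_integrable_def)
    finally show ?thesis by (simp add: l2norm_square)
  qed
  have "ennreal (\<integral>\<sigma>. (f \<sigma> - (\<integral>\<tau>. f \<tau> \<partial>P))\<^sup>2 \<partial>P) \<le> ennreal CP * dirichlet P f" if f: "L2 f" for f
  \<comment> \<open>The finite set \<open>S\<close> varies with \<open>e\<close>, but each finite
    sum is below the same Dirichlet form, so \<open>e\<close> can tend to 0; an infinite form is
    covered as well.\<close>
  proof (rule ennreal_le_epsilon)
    fix e :: real assume e: "e > 0"
    from variance_bound[OF f e] obtain S where S: "finite S"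
      "(\<integral>\<sigma>. (f \<sigma> - (\<integral>\<tau>. f \<tau> \<partial>P))\<^sup>2 \<partial>P) \<le>
        (\<Sum>x\<in>S. (nrm (D x f))\<^sup>2) / (1 - 2 * \<beta> * real (2 * CARD('d))) + e" by blast
    have "1 - 2 * \<beta> * real (2 * CARD('d)) = 1 - s" by (simp add: s_def)
    with S(2) have "(\<integral>\<sigma>. (f \<sigma> - (\<integral>\<tau>. f \<tau> \<partial>P))\<^sup>2 \<partial>P) \<le> CP * (\<Sum>x\<in>S. (nrm (D x f))\<^sup>2) + e"
      by (simp add: CP_def)
    then have "ennreal (\<integral>\<sigma>. (f \<sigma> - (\<integral>\<tau>. f \<tau> \<partial>P))\<^sup>2 \<partial>P) \<le> ennreal (CP * (\<Sum>x\<in>S. (nrm (D x f))\<^sup>2) + e)"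
      by (rule ennreal_leI)
    also have "\<dots> = ennreal CP * (\<Sum>x\<in>S. ennreal ((nrm (D x f))\<^sup>2)) + ennreal e"
      using CP e by (simp add: ennreal_plus ennreal_mult sum_nonneg)
    also have "(\<Sum>x\<in>S. ennreal ((nrm (D x f))\<^sup>2)) \<le> dirichlet P f"
      using sum_le_dirichlet[OF S(1), where f = f and P = P] by (simp add: flip[OF f])
    finally show "ennreal (\<integral>\<sigma>. (f \<sigma> - (\<integral>\<tau>. f \<tau> \<partial>P))\<^sup>2 \<partial>P) \<le> ennreal CP * dirichlet P f + ennreal e"
      by (simp add: mult_left_mono add_right_mono)
  qed
  then show ?thesis using CP by (intro exI[of _ CP]) (auto simp: sq_integrable_def)
qed

end
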